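(* Let $\mathcal U$ be a domain in $\mathbb R^2$, let $f:\mathcal U\to\mathbb R^3$ be a front into the Euclidean $3$-space, and let $p\in\mathcal U$ be a non-degenerate singular point of $f$. Then the following three properties are equivalent: (1) the Gaussian curvature of $f$ is rationally bounded at $p$; (2) the limiting normal curvature $\kappa_\nu(p)$ is equal to zero; (3) $p$ is also a singular point of the Gauss map $\nu$ of $f$ (that is, $\nu$ is not an immersion at $p$).
   Context: All maps are $C^\infty$. A singular point of $f$ is a point at which $f$ is not an immersion; other points are regular. $f$ is a frontal if around each point there is a unit vector field $\nu$ along $f$ orthogonal to $df(a)$ for all tangent vectors $a$; it is a front if moreover $\nu$, regarded as a map into $T\mathbb R^3$ (i.e. $(f,\nu)$), is an immersion. A unit normal field $\nu$ is fixed (near $p$); by parallel translation it is regarded as a map into $S^2$, the Gauss map. Non-degenerate singular points: with $\lambda=\det(f_u,f_v,\nu)$ for a positively oriented local coordinate system $(u,v)$, a singular point $p$ is non-degenerate if $d\lambda(p)\ne0$; then $df(p)$ has rank one. Limiting normal curvature: for a singular point $p$ at which $df(p)$ has rank one, take a positively oriented local coordinate system $(u,v)$ centered at $p$ with $f_v(p)=0$. Then $\kappa_\nu(p):=\langle f_{uu}(p),\nu(p)\rangle/|f_u(p)|^2$, independent of the choice of such coordinates. Gaussian curvature: $K$ is the Gaussian curvature of the induced metric on the set of regular points. Rational boundedness: on $\mathbb R\times S^1$ ($S^1=\mathbb R/2\pi\mathbb Z$) let $(r,\theta)\sim(-r,\theta+\pi)$, let $\mathcal M$ be the quotient and $\pi$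 the projection, and let $\Phi:\mathcal M\to\mathbb R^2$ be the map with $\Phi(\pi(r,\theta))=(r\cos\theta,r\sin\theta)$. Transplanting by a local coordinate system centered at $p$ gives the blow up $\Phi:\hat\Sigma^2_p\to\Sigma^2$ of a surface $\Sigma^2$ at $p$ (independent of the coordinates). Let $W$ be a neighborhood of $p$ and $\mathcal O$ an open dense subset of $W$. A $C^\infty$ function $\varphi:\mathcal O\to\mathbb R$ is rationally bounded at $p$ if there is a $C^\infty$ function $\rho:\Phi^{-1}(W)\to\mathbb R$ such that (a) $\Phi^{-1}(\mathcal O\setminus\{p\})=\Phi^{-1}(W\setminus\{p\})\cap\rho^{-1}(\mathbb R\setminus\{0\})$; (b) $\rho^{-1}(0)\cap\Phi^{-1}(p)$ is a finite set; (c) there is a $C^\infty$ function $\psi:\Phi^{-1}(W)\to\mathbb R$ with $\psi(q)=\rho(q)\,\varphi(\Phi(q))$ for $q\in\Phi^{-1}(\mathcal O)$. For $\varphi=K$, one takes $W$ a sufficiently small neighborhood of $p$ and $\mathcal O$ the set of regular points of $f$ in $W$. *)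

theory Defs
  imports "HOL-Analysis.Analysis"
begin

(* For open S in a finite-dimensional space: all derivatives up to order n exist and are
   continuous on S. *)
primrec Ck_on :: "nat \<Rightarrow> ('a::real_normed_vector \<Rightarrow> 'b::real_normed_vector) \<Rightarrow> 'a set \<Rightarrow> bool" where
  "Ck_on 0 f S \<longleftrightarrow> continuous_on S f"
| "Ck_on (Suc n) f S \<longleftrightarrow>
     (\<forall>x\<in>S. f differentiable (at x)) \<and> (\<forall>v. Ck_on n (\<lambda>x. frechet_derivative f (at x) v) S)"

definition smooth_on :: "('a::real_normed_vector \<Rightarrow> 'b::real_normed_vector) \<Rightarrow> 'a set \<Rightarrow> bool" where
  "smooth_on f S \<longleftrightarrow> (\<forall>n. Ck_on n f S)"

definition immersion_at :: "('a::real_normed_vector \<Rightarrow> 'b::real_normed_vector) \<Rightarrow> 'a \<Rightarrow> bool" where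
  "immersion_at f q \<longleftrightarrow> inj (frechet_derivative f (at q))"

definition pderiv_at :: "2 \<Rightarrow> (real^2 \<Rightarrow> 'b::real_normed_vector) \<Rightarrow> real^2 \<Rightarrow> 'b" where
  "pderiv_at i f q = frechet_derivative f (at q) (axis i 1)"


subsection \<open>Fronts\<close>

definition unit_normal_field :: "(real^2) set \<Rightarrow> (real^2 \<Rightarrow> real^3) \<Rightarrow> (real^2 \<Rightarrow> real^3) \<Rightarrow> bool" where
  "unit_normal_field V f \<nu> \<longleftrightarrow>
     smooth_on \<nu> V \<and>
     (\<forall>q\<in>V. norm (\<nu> q) = 1 \<and> (\<forall>a. frechet_derivative f (at q) a \<bullet> \<nu> q = 0))"

definition front :: "(real^2) set \<Rightarrow> (real^2 \<Rightarrow> real^3) \<Rightarrow> bool" where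
  "front U f \<longleftrightarrow>
     smooth_on f U \<and>
     (\<forall>q\<in>U. \<exists>V \<nu>. open V \<and> q \<in> V \<and> V \<subseteq> U \<and> unit_normal_field V f \<nu> \<and>
        (\<forall>x\<in>V. immersion_at (\<lambda>y. (f y, \<nu> y)) x))"

definition signed_area_density :: "(real^2 \<Rightarrow> real^3) \<Rightarrow> (real^2 \<Rightarrow> real^3) \<Rightarrow> real^2 \<Rightarrow> real" where
  "signed_area_density f \<nu> q = det (vector [pderiv_at 1 f q, pderiv_at 2 f q, \<nu> q] :: real^3^3)"

definition nondegenerate_singular_point ::
    "(real^2 \<Rightarrow> real^3) \<Rightarrow> (real^2 \<Rightarrow> real^3) \<Rightarrow> real^2 \<Rightarrow> bool" where
  "nondegenerate_singular_point f \<nu> p \<longleftrightarrow>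
     \<not> immersion_at f p \<and> frechet_derivative (signed_area_density f \<nu>) (at p) \<noteq> (\<lambda>_. 0)"


subsection \<open>Limiting normal curvature\<close>

(* A coordinate system (u,v) is represented by its inverse x, defined on an open set D of
   coordinate values; y is the coordinate map itself. *)
definition oriented_coordinates_at :: "real^2 \<Rightarrow> (real^2) set \<Rightarrow> (real^2 \<Rightarrow> real^2) \<Rightarrow> bool" where
  "oriented_coordinates_at p D x \<longleftrightarrow>
     open D \<and> 0 \<in> D \<and> x 0 = p \<and> smooth_on x D \<and> open (x ` D) \<and>
     (\<exists>y. smooth_on y (x ` D) \<and> (\<forall>d\<in>D. y (x d) = d)) \<and>
     (\<forall>d\<in>D. 0 < det (matrix (frechet_derivative x (at d))))"

definition limiting_normal_curvature ::
    "(real^2 \<Rightarrow> real^3) \<Rightarrow> (real^2 \<Rightarrow> real^3) \<Rightarrow> real^2 \<Rightarrow> real" where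
  "limiting_normal_curvature f \<nu> p =
     (THE \<kappa>. \<exists>D x. oriented_coordinates_at p D x \<and> pderiv_at 2 (f \<circ> x) 0 = 0 \<and>
        \<kappa> = (pderiv_at 1 (pderiv_at 1 (f \<circ> x)) 0 \<bullet> \<nu> p) / (norm (pderiv_at 1 (f \<circ> x) 0))\<^sup>2)"


subsection \<open>Gaussian curvature of the induced metric\<close>

type_synonym metric = "real^2 \<Rightarrow> real^2^2"

definition induced_metric :: "(real^2 \<Rightarrow> real^3) \<Rightarrow> metric" where
  "induced_metric f q = (\<chi> i j. pderiv_at i f q \<bullet> pderiv_at j f q)"

(* Gamma^k_ij of the Levi-Civita connection. *)
definition christoffel :: "metric \<Rightarrow> 2 \<Rightarrow> 2 \<Rightarrow> 2 \<Rightarrow> real^2 \<Rightarrow> real" where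
  "christoffel g k i j q =
     (\<Sum>l\<in>UNIV. matrix_inv (g q) $ k $ l *
        (pderiv_at i (\<lambda>x. g x $ j $ l) q + pderiv_at j (\<lambda>x. g x $ i $ l) q
          - pderiv_at l (\<lambda>x. g x $ i $ j) q)) / 2"

(* The l-th component of R(d_i, d_j) d_k, where R(X,Y) = [D_X, D_Y] - D_[X,Y]. *)
definition riemann_curvature :: "metric \<Rightarrow> 2 \<Rightarrow> 2 \<Rightarrow> 2 \<Rightarrow> 2 \<Rightarrow> real^2 \<Rightarrow> real" where
  "riemann_curvature g l i j k q =
     pderiv_at i (christoffel g l j k) q - pderiv_at j (christoffel g l i k) q
     + (\<Sum>m\<in>UNIV. christoffel g m j k q * christoffel g l i m q
                 - christoffel g m i k q * christoffel g l j m q)"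

(* K = <R(d_1, d_2) d_2, d_1> / det g; meaningful only where g is non-singular. *)
definition gaussian_curvature :: "metric \<Rightarrow> real^2 \<Rightarrow> real" where
  "gaussian_curvature g q =
     (\<Sum>l\<in>UNIV. riemann_curvature g l 1 2 2 q * g q $ l $ 1) / det (g q)"


subsection \<open>Blow up and rational boundedness\<close>

(* The circle is R/2piZ, so the quotient of R x S^1 by (r,t) ~ (-r,t+pi) is the quotient of R x R
   by the group generated by (r,t) |-> (-r,t+pi); its square is the shift of t by 2pi. *)
definition blowup_rel :: "real \<times> real \<Rightarrow> real \<times> real \<Rightarrow> bool" where
  "blowup_rel a b \<longleftrightarrow>
     (\<exists>k::int. fst b = (if even k then fst a else - fst a) \<and> snd b = snd a + of_int k * pi)"

lemma equivp_blowup_rel: "equivp blowup_rel"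
proof (rule equivpI)
  show "reflp blowup_rel"
    by (rule reflpI) (auto simp: blowup_rel_def intro: exI[of _ 0])
  show "symp blowup_rel"
  proof (rule sympI)
    fix a b assume "blowup_rel a b"
    then obtain k :: int where
      k: "fst b = (if even k then fst a else - fst a)" "snd b = snd a + of_int k * pi"
      unfolding blowup_rel_def by blast
    then show "blowup_rel b a"
      unfolding blowup_rel_def by (intro exI[of _ "- k"]) auto
  qed
  show "transp blowup_rel"
  proof (rule transpI)
    fix a b c assume "blowup_rel a b" "blowup_rel b c"
    then obtain k l :: int where
      "fst b = (if even k then fst a else - fst a)" "snd b = snd a + of_int k * pi"
      "fst c = (if even l then fst b else - fst b)" "snd c = snd b + of_int l * pi"
      unfolding blowup_rel_def by blast
    then show "blowup_rel a c"
      unfolding blowup_rel_def by (intro exI[of _ "k + l"]) (auto simp: algebra_simps)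
  qed
qed

quotient_type blowup = "real \<times> real" / blowup_rel
  by (rule equivp_blowup_rel)

lift_definition blowup_proj :: "real \<times> real \<Rightarrow> blowup" is "\<lambda>a. a" .

definition polar :: "real \<times> real \<Rightarrow> real^2" where
  "polar a = vector [fst a * cos (snd a), fst a * sin (snd a)]"

lift_definition blowup_map :: "blowup \<Rightarrow> real^2" is polar
proof -
  fix a b :: "real \<times> real"
  assume "blowup_rel a b"
  then obtain k :: int where
    k: "fst b = (if even k then fst a else - fst a)" "snd b = snd a + of_int k * pi"
    unfolding blowup_rel_def by blast
  have s: "sin (of_int k * pi) = 0"
    by (simp add: sin_zero_iff_int2)
  have c: "cos (of_int k * pi) = (if even k then 1 else -1)"
    using cos_npi_int[of k] by (simp add: mult.commute)
  show "polar a = polar b"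
    using k s c by (auto simp: polar_def sin_add cos_add)
qed

(* The blow up of the plane at p, formed in the coordinate system x - p centered at p. *)
definition blowup_map_at :: "real^2 \<Rightarrow> blowup \<Rightarrow> real^2" where
  "blowup_map_at p m = p + blowup_map m"

(* Smoothness on an open subset of the blow up; the projection is a local diffeomorphism. *)
definition blowup_smooth_on :: "(blowup \<Rightarrow> real) \<Rightarrow> blowup set \<Rightarrow> bool" where
  "blowup_smooth_on \<rho> S \<longleftrightarrow> smooth_on (\<rho> \<circ> blowup_proj) (blowup_proj -` S)"

definition rationally_bounded_at ::
    "real^2 \<Rightarrow> (real^2) set \<Rightarrow> (real^2) set \<Rightarrow> (real^2 \<Rightarrow> real) \<Rightarrow> bool" where
  "rationally_bounded_at p W \<O> \<phi> \<longleftrightarrow>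
     open W \<and> p \<in> W \<and> open \<O> \<and> \<O> \<subseteq> W \<and> W \<subseteq> closure \<O> \<and> smooth_on \<phi> \<O> \<and>
     (let \<Phi> = blowup_map_at p in
      \<exists>\<rho>. blowup_smooth_on \<rho> (\<Phi> -` W) \<and>
        \<Phi> -` (\<O> - {p}) = \<Phi> -` (W - {p}) \<inter> \<rho> -` (UNIV - {0}) \<and>
        finite (\<rho> -` {0} \<inter> \<Phi> -` {p}) \<and>
        (\<exists>\<psi>. blowup_smooth_on \<psi> (\<Phi> -` W) \<and>
             (\<forall>q \<in> \<Phi> -` \<O>. \<psi> q = \<rho> q * \<phi> (\<Phi> q))))"

(* Rational boundedness on W restricts to smaller neighborhoods of p, so "for some W" and
   "for all sufficiently small W" agree. *)
definition gaussian_curvature_rationally_bounded ::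
    "(real^2) set \<Rightarrow> (real^2 \<Rightarrow> real^3) \<Rightarrow> real^2 \<Rightarrow> bool" where
  "gaussian_curvature_rationally_bounded U f p \<longleftrightarrow>
     (\<exists>W \<subseteq> U. rationally_bounded_at p W {q \<in> W. immersion_at f q}
                (gaussian_curvature (induced_metric f)))"

end

(* The Gauss equation gives K = mu / lambda on the regular set, where lambda = det (f_u, f_v, nu) and
   mu = det (nu_u, nu_v, nu); moreover nu is an immersion at p iff mu(p) is non-zero.

   On the blow up, a smooth function vanishing at p has the form r * (smooth function) by Hadamard's
   lemma. If mu(p) = 0, write lambda = r l and mu = r m; then K = m / l, and rho = l^2, psi = l m
   witness rational boundedness, since l restricted to the exceptional circle is the linear form
   d lambda(p). Conversely, psi lambda = rho mu near the exceptional circle, and letting r tend to 0 in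
   a direction where rho and d lambda(p) do not vanish gives mu(p) = 0.

   The limiting normal curvature is - <df a, dnu a> / |df a|^2 for any a outside the kernel of df(p).
   The front condition makes dnu w non-zero for w in that kernel, and dnu w is orthogonal to df a and
   nu by symmetry of the second fundamental form; so <df a, dnu a> = 0 iff dnu(p) is not injective. *)

theory Submission
  imports Defs
begin

subsection \<open>Calculus of smooth maps\<close>

text \<open>The curvature in the claim is intrinsic, built from Christoffel symbols whose inverse
  metric degenerates at \<open>p\<close>. The Gauss equation is therefore proved on the regular set
  only, in the lowered form Gamma^k_ij g_km = <f_ij, f_m>, so that the inverse metric cancels before
  the Christoffel symbols are differentiated. Towards \<open>p\<close> it is used with denominators
  cleared.

  The front condition speaks of some local normal \<open>n\<close>, not of the given
  \<open>\<nu>\<close>. At a singular point the image of df does not determine the normal line, so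
  \<open>n\<close> and \<open>\<nu>\<close> are compared through nearby regular points. These are
  dense because d lambda does not vanish near \<open>p\<close>; then n = s \<nu> with s^2 = 1, and s
  has derivative zero.

  The limiting normal curvature is a definite description over all adapted coordinates. Its value is
  well defined because a component along the kernel of df(p) changes neither df a nor <df a, dnu a>,
  and rescaling a changes the latter and |df a|^2 by the same factor.\<close>

lemma frechet_derivative_cong_open:
  assumes "open S" "x \<in> S" "\<And>y. y \<in> S \<Longrightarrow> f y = g y"
  shows "frechet_derivative f (at x) = frechet_derivative g (at x)"
proof -
  \<comment> \<open>No differentiability is assumed: \<open>frechet_derivative\<close> is a choice
    from the predicate \<open>has_derivative\<close>, so equal predicates give equal
    choices.\<close>
  have "(f has_derivative D) (at x) \<longleftrightarrow> (g has_derivative D) (at x)" for D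
    using assms by (metis has_derivative_transform_within_open)
  then show ?thesis by (simp add: frechet_derivative_def)
qed

lemma differentiable_cong_open:
  assumes "open S" "x \<in> S" "\<And>y. y \<in> S \<Longrightarrow> f y = g y" "f differentiable at x"
  shows "g differentiable at x"
  using assms unfolding differentiable_def by (metis has_derivative_transform_within_open)

lemma frechet_derivative_works':
  "f differentiable at x \<Longrightarrow> (f has_derivative (\<lambda>v. frechet_derivative f (at x) v)) (at x)"
  by (simp add: frechet_derivative_works)

lemma Ck_on_cong:
  assumes "open S" "\<And>y. y \<in> S \<Longrightarrow> f y = g y" "Ck_on n f S"
  shows "Ck_on n g S"
  using assms
proof (induction n arbitrary: f g)
  case 0
  then show ?case using continuous_on_cong[of S S f g] by auto
next
  case (Suc n)
  have "Ck_on n (\<lambda>x. frechet_derivative g (at x) v) S" for v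
  proof (rule Suc.IH[OF Suc.prems(1)])
    show "Ck_on n (\<lambda>x. frechet_derivative f (at x) v) S"
      using Suc.prems(3) by simp
    show "frechet_derivative f (at y) v = frechet_derivative g (at y) v" if "y \<in> S" for y
      using frechet_derivative_cong_open[OF Suc.prems(1) that Suc.prems(2)] by simp
  qed
  moreover have "g differentiable at x" if "x \<in> S" for x
    using differentiable_cong_open[OF Suc.prems(1) that Suc.prems(2)] Suc.prems(3) that by simp
  ultimately show ?case by simp
qed

text \<open>Lets an explicit derivative formula replace the chosen
  \<open>frechet_derivative\<close>; the product, chain and reciprocal rules below are inductions on
  the order through it.\<close>

lemma Ck_on_SucI:
  assumes "open S" "\<And>x. x \<in> S \<Longrightarrow> (f has_derivative D x) (at x)" "\<And>v. Ck_on n (\<lambda>x. D x v) S"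
  shows "Ck_on (Suc n) f S"
proof -
  have "frechet_derivative f (at x) = D x" if "x \<in> S" for x
    using assms(2) frechet_derivative_at that by metis
  then have "Ck_on n (\<lambda>x. frechet_derivative f (at x) v) S" for v
    by (intro Ck_on_cong[OF assms(1) _ assms(3)[of v]]) simp
  then show ?thesis
    using assms(2) by (auto simp: differentiable_def)
qed

lemma Ck_on_SucD: "Ck_on (Suc n) f S \<Longrightarrow> Ck_on n f S"
proof (induction n arbitrary: f)
  case 0
  then show ?case
    by (auto intro!: differentiable_imp_continuous_within continuous_at_imp_continuous_on)
next
  case (Suc n)
  then show ?case
    by (metis Ck_on.simps(2))
qed

lemma Ck_on_subset: "Ck_on n f S \<Longrightarrow> T \<subseteq> S \<Longrightarrow> Ck_on n f T"
  by (induction n arbitrary: f) (auto intro: continuous_on_subset)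

lemma Ck_on_const: "Ck_on n (\<lambda>_. c) S"
  by (induction n arbitrary: c) auto

lemma Ck_on_bounded_linear:
  assumes "bounded_linear h" "open S" "Ck_on n f S"
  shows "Ck_on n (\<lambda>x. h (f x)) S"
  using assms(3)
proof (induction n arbitrary: f)
  case 0
  then show ?case
    using assms(1) by (simp add: bounded_linear.continuous_on)
next
  case (Suc n)
  show ?case
  proof (rule Ck_on_SucI[OF assms(2)])
    show "((\<lambda>x. h (f x)) has_derivative (\<lambda>v. h (frechet_derivative f (at x) v))) (at x)"
      if "x \<in> S" for x
      using Suc.prems that by (auto intro!: bounded_linear.has_derivative[OF assms(1)] frechet_derivative_works')
    show "Ck_on n (\<lambda>x. h (frechet_derivative f (at x) v)) S" for v
      using Suc.prems by (intro Suc.IH) simp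
  qed
qed

lemma Ck_on_add:
  assumes "open S" "Ck_on n f S" "Ck_on n g S"
  shows "Ck_on n (\<lambda>x. f x + g x) S"
  using assms(2,3)
proof (induction n arbitrary: f g)
  case 0
  then show ?case by (auto intro: continuous_on_add)
next
  case (Suc n)
  show ?case
  proof (rule Ck_on_SucI[OF assms(1)])
    show "((\<lambda>x. f x + g x) has_derivative
        (\<lambda>v. frechet_derivative f (at x) v + frechet_derivative g (at x) v)) (at x)"
      if "x \<in> S" for x
      using Suc.prems that by (auto intro!: has_derivative_add frechet_derivative_works')
    show "Ck_on n (\<lambda>x. frechet_derivative f (at x) v + frechet_derivative g (at x) v) S" for v
      using Suc.prems by (intro Suc.IH) simp_all
  qed
qed

lemma Ck_on_bilinear:
  assumes "bounded_bilinear h" "open S" "Ck_on n f S" "Ck_on n g S"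
  shows "Ck_on n (\<lambda>x. h (f x) (g x)) S"
  using assms(3,4)
proof (induction n arbitrary: f g)
  case 0
  then show ?case
    using assms(1) by (simp add: bounded_bilinear.continuous_on)
next
  case (Suc n)
  show ?case
  proof (rule Ck_on_SucI[OF assms(2)])
    show "((\<lambda>x. h (f x) (g x)) has_derivative
        (\<lambda>v. h (f x) (frechet_derivative g (at x) v) + h (frechet_derivative f (at x) v) (g x))) (at x)"
      if "x \<in> S" for x
      using Suc.prems that
      by (auto intro!: bounded_bilinear.FDERIV[OF assms(1)] frechet_derivative_works')
    show "Ck_on n (\<lambda>x. h (f x) (frechet_derivative g (at x) v)
        + h (frechet_derivative f (at x) v) (g x)) S" for v
      \<comment> \<open>The product rule pairs each derivative with an undifferentiated factor,
        whose order is lowered from \<open>Suc n\<close> to \<open>n\<close>.\<close>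
      using Suc.prems Ck_on_SucD[OF Suc.prems(1)] Ck_on_SucD[OF Suc.prems(2)]
      by (intro Ck_on_add[OF assms(2)] Suc.IH) simp_all
  qed
qed

lemma Ck_on_sum:
  assumes "open S" "finite I" "\<And>i. i \<in> I \<Longrightarrow> Ck_on n (f i) S"
  shows "Ck_on n (\<lambda>x. \<Sum>i\<in>I. f i x) S"
  using assms(2,3)
proof (induction I)
  case empty
  show ?case by (simp add: Ck_on_const)
next
  case (insert i I)
  then show ?case by (simp add: Ck_on_add[OF assms(1)])
qed

lemma linear_sum_Basis:
  fixes L :: "'a::euclidean_space \<Rightarrow> 'b::real_normed_vector"
  assumes "linear L"
  shows "L v = (\<Sum>b\<in>Basis. (v \<bullet> b) *\<^sub>R L b)"
  using linear_sum[OF assms, of "\<lambda>b. (v \<bullet> b) *\<^sub>R b" Basis] linear_cmul[OF assms]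
  by (simp add: euclidean_representation)

text \<open>\<open>Ck_on\<close> controls derivatives in fixed directions, but the chain rule
  evaluates the derivative of \<open>g\<close> in a direction that moves with \<open>x\<close>.
  Expanding that direction in \<open>Basis\<close> of the middle space turns the derivative into a
  finite sum of products, to which the induction hypothesis applies.\<close>

lemma Ck_on_compose:
  fixes f :: "'a::real_normed_vector \<Rightarrow> 'b::euclidean_space"
    and g :: "'b \<Rightarrow> 'c::real_normed_vector"
  assumes "open S" "open T" "\<And>x. x \<in> S \<Longrightarrow> f x \<in> T" "Ck_on n f S" "Ck_on n g T"
  shows "Ck_on n (\<lambda>x. g (f x)) S"
  using assms(4,5)
proof (induction n arbitrary: g)
  case 0
  then show ?case
    using assms(3) by (auto intro: continuous_on_compose2)
next
  case (Suc n)
  have fn: "Ck_on n f S" using Suc.prems(1) by (rule Ck_on_SucD)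
  let ?D = "\<lambda>x v. frechet_derivative g (at (f x)) (frechet_derivative f (at x) v)"
  show ?case
  proof (rule Ck_on_SucI[OF assms(1), where D = ?D])
    fix x assume x: "x \<in> S"
    show "((\<lambda>x. g (f x)) has_derivative ?D x) (at x)"
      using Suc.prems assms(3) x
      by (intro has_derivative_compose[of f _ x UNIV g]) (auto intro!: frechet_derivative_works')
  next
    fix v
    have S: "Ck_on n (\<lambda>x. \<Sum>b\<in>Basis. (frechet_derivative f (at x) v \<bullet> b) *\<^sub>R
        frechet_derivative g (at (f x)) b) S"
      using Suc.prems
      by (intro Ck_on_sum Ck_on_bilinear[OF bounded_bilinear_scaleR] assms(1) finite_Basis
          Ck_on_bounded_linear[OF bounded_linear_inner_left] Suc.IH fn) simp_all
    have "?D x v = (\<Sum>b\<in>Basis. (frechet_derivative f (at x) v \<bullet> b) *\<^sub>R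
        frechet_derivative g (at (f x)) b)" if "x \<in> S" for x
      using Suc.prems(2) assms(3)[OF that]
      by (intro linear_sum_Basis linear_frechet_derivative) auto
    then show "Ck_on n (\<lambda>x. ?D x v) S"
      by (intro Ck_on_cong[OF assms(1) _ S]) simp
  qed
qed

lemma Ck_on_inverse: "Ck_on n (inverse :: real \<Rightarrow> real) (- {0})"
proof (induction n)
  case 0
  show ?case by (auto intro!: continuous_intros)
next
  case (Suc n)
  have "Ck_on n (\<lambda>x::real. - (inverse x * v * inverse x)) (- {0})" for v
    by (intro Ck_on_bounded_linear[OF bounded_linear_minus[OF bounded_linear_ident]]
        Ck_on_bilinear[OF bounded_bilinear_mult] Ck_on_const Suc open_Compl closed_singleton)
  then show ?case
    by (intro Ck_on_SucI[where D = "\<lambda>x v. - (inverse x * v * inverse x)"])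
       (simp_all add: open_Compl has_derivative_inverse')
qed

lemma Ck_on_sin_cos: "Ck_on n (sin :: real \<Rightarrow> real) UNIV \<and> Ck_on n (cos :: real \<Rightarrow> real) UNIV"
proof (induction n)
  case 0
  show ?case by (auto intro!: continuous_intros)
next
  case (Suc n)
  have "Ck_on n (\<lambda>x. v * cos x) UNIV" "Ck_on n (\<lambda>x. - v * sin x) UNIV" for v :: real
    by (intro Ck_on_bilinear[OF bounded_bilinear_mult open_UNIV Ck_on_const]
        conjunct1[OF Suc] conjunct2[OF Suc])+
  moreover have "(sin has_derivative (\<lambda>v. v * cos x)) (at x)"
    "(cos has_derivative (\<lambda>v. - v * sin x)) (at x)" for x :: real
    by (auto intro!: derivative_eq_intros)
  ultimately show ?case
    by (intro conjI Ck_on_SucI[OF open_UNIV])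
qed

section \<open>Closure properties of smooth maps\<close>

lemma smooth_on_cong:
  assumes "open S" "smooth_on f S" "\<And>y. y \<in> S \<Longrightarrow> f y = g y"
  shows "smooth_on g S"
  using Ck_on_cong[OF assms(1,3)] assms(2) by (simp add: smooth_on_def)

lemma smooth_on_subset: "smooth_on f S \<Longrightarrow> T \<subseteq> S \<Longrightarrow> smooth_on f T"
  by (simp add: smooth_on_def Ck_on_subset[of _ f S T])

lemma smooth_on_continuous: "smooth_on f S \<Longrightarrow> continuous_on S f"
  unfolding smooth_on_def by (metis Ck_on.simps(1))

lemma smooth_on_differentiable: "smooth_on f S \<Longrightarrow> x \<in> S \<Longrightarrow> f differentiable at x"
  unfolding smooth_on_def by (metis Ck_on.simps(2))

lemma smooth_on_derivative: "smooth_on f S \<Longrightarrow> smooth_on (\<lambda>x. frechet_derivative f (at x) v) S"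
  unfolding smooth_on_def by (metis Ck_on.simps(2))

lemma smooth_on_const: "smooth_on (\<lambda>_. c) S"
  by (simp add: smooth_on_def Ck_on_const)

lemma smooth_on_ident: "smooth_on (\<lambda>x. x) S"
  unfolding smooth_on_def
proof
  fix n show "Ck_on n (\<lambda>x. x) S" by (cases n) (auto intro: Ck_on_const)
qed

lemma smooth_on_bounded_linear:
  assumes "bounded_linear h" "open S" "smooth_on f S"
  shows "smooth_on (\<lambda>x. h (f x)) S"
  using assms(3) Ck_on_bounded_linear[OF assms(1,2), of _ f] by (simp add: smooth_on_def)

lemma smooth_on_minus: "open S \<Longrightarrow> smooth_on f S \<Longrightarrow> smooth_on (\<lambda>x. - f x) S"
  by (rule smooth_on_bounded_linear[OF bounded_linear_minus[OF bounded_linear_ident]])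

lemma smooth_on_add:
  assumes "open S" "smooth_on f S" "smooth_on g S"
  shows "smooth_on (\<lambda>x. f x + g x) S"
  using assms(2,3) Ck_on_add[OF assms(1), of _ f g] by (simp add: smooth_on_def)

lemma smooth_on_diff:
  assumes "open S" "smooth_on f S" "smooth_on g S"
  shows "smooth_on (\<lambda>x. f x - g x) S"
  using smooth_on_add[OF assms(1,2) smooth_on_minus[OF assms(1,3)]] by simp

lemma smooth_on_bilinear:
  assumes "bounded_bilinear h" "open S" "smooth_on f S" "smooth_on g S"
  shows "smooth_on (\<lambda>x. h (f x) (g x)) S"
  using assms(3,4) Ck_on_bilinear[OF assms(1,2), of _ f g] by (simp add: smooth_on_def)

lemmas smooth_on_inner = smooth_on_bilinear[OF bounded_bilinear_inner]
lemmas smooth_on_mult = smooth_on_bilinear[OF bounded_bilinear_mult]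
lemmas smooth_on_scaleR = smooth_on_bilinear[OF bounded_bilinear_scaleR]

lemma smooth_on_compose:
  fixes f :: "'a::real_normed_vector \<Rightarrow> 'b::euclidean_space"
  assumes "open S" "open T" "\<And>x. x \<in> S \<Longrightarrow> f x \<in> T" "smooth_on f S" "smooth_on g T"
  shows "smooth_on (\<lambda>x. g (f x)) S"
  unfolding smooth_on_def
proof
  fix n
  show "Ck_on n (\<lambda>x. g (f x)) S"
    by (rule Ck_on_compose[OF assms(1-3)]) (use assms(4,5) in \<open>simp_all add: smooth_on_def\<close>)
qed

lemma smooth_on_divide:
  fixes f g :: "'a::real_normed_vector \<Rightarrow> real"
  assumes "open S" "smooth_on f S" "smooth_on g S" "\<And>x. x \<in> S \<Longrightarrow> g x \<noteq> 0"
  shows "smooth_on (\<lambda>x. f x / g x) S"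
proof -
  have "smooth_on (\<lambda>x. inverse (g x)) S"
    by (rule smooth_on_compose[OF assms(1) _ _ assms(3), of "- {0}"])
       (simp_all add: smooth_on_def Ck_on_inverse assms(4) open_Compl)
  then show ?thesis
    using smooth_on_mult[OF assms(1,2), of "\<lambda>x. inverse (g x)"] by (simp add: divide_inverse)
qed

section \<open>Symmetry of mixed second derivatives\<close>

lemma has_real_derivative_along_line:
  fixes g :: "'a::real_normed_vector \<Rightarrow> real"
  assumes "g differentiable at (y + s *\<^sub>R b)"
  shows "((\<lambda>s. g (y + s *\<^sub>R b)) has_real_derivative
    frechet_derivative g (at (y + s *\<^sub>R b)) b) (at s)"
proof -
  have "((\<lambda>s. g (y + s *\<^sub>R b)) has_derivative
      (\<lambda>h. frechet_derivative g (at (y + s *\<^sub>R b)) (h *\<^sub>R b))) (at s)"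
    by (rule has_derivative_compose[where g = g])
       (auto intro!: derivative_eq_intros frechet_derivative_works' assms)
  moreover have "frechet_derivative g (at (y + s *\<^sub>R b)) (h *\<^sub>R b) =
      frechet_derivative g (at (y + s *\<^sub>R b)) b * h" for h
    using linear_cmul[OF linear_frechet_derivative[OF assms], of h b] by simp
  ultimately show ?thesis
    by (simp add: has_field_derivative_def)
qed

text \<open>Both orders of differentiation are read off from the same second difference by applying the
  mean value theorem twice.\<close>

lemma second_difference_mean_value:
  fixes f :: "'a::real_normed_vector \<Rightarrow> real"
  assumes f: "\<And>y. y \<in> ball x e \<Longrightarrow> f differentiable at y"
    and f': "\<And>y. y \<in> ball x e \<Longrightarrow> (\<lambda>z. frechet_derivative f (at z) a) differentiable at y"
    and t: "0 < t" "t * (norm a + norm b) < e"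
  obtains \<xi> \<eta> where "0 < \<xi>" "\<xi> < t" "0 < \<eta>" "\<eta> < t"
    "f (x + t *\<^sub>R a + t *\<^sub>R b) - f (x + t *\<^sub>R a) - f (x + t *\<^sub>R b) + f x =
     t * t * frechet_derivative (\<lambda>z. frechet_derivative f (at z) a) (at (x + \<xi> *\<^sub>R a + \<eta> *\<^sub>R b)) b"
proof -
  have in_ball: "x + s *\<^sub>R a + r *\<^sub>R b \<in> ball x e" if "0 \<le> s" "s \<le> t" "0 \<le> r" "r \<le> t" for s r
  proof -
    have "norm (s *\<^sub>R a + r *\<^sub>R b) \<le> s * norm a + r * norm b"
      using norm_triangle_ineq[of "s *\<^sub>R a" "r *\<^sub>R b"] that by simp
    also have "\<dots> \<le> t * norm a + t * norm b"
      using that by (intro add_mono mult_right_mono) auto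
    finally show ?thesis
      using t by (simp add: dist_norm algebra_simps norm_minus_commute)
  qed
  define g where "g s = f (x + s *\<^sub>R a + t *\<^sub>R b) - f (x + s *\<^sub>R a)" for s
  have line: "((\<lambda>s. f (x + s *\<^sub>R a + c)) has_real_derivative
      frechet_derivative f (at (x + s *\<^sub>R a + c)) a) (at s)"
    if "x + s *\<^sub>R a + c \<in> ball x e" for s c
    using has_real_derivative_along_line[of f "x + c" s a] f[OF that] by (simp add: ac_simps)
  have dg: "(g has_real_derivative frechet_derivative f (at (x + s *\<^sub>R a + t *\<^sub>R b)) a
      - frechet_derivative f (at (x + s *\<^sub>R a)) a) (at s)" if "0 \<le> s" "s \<le> t" for s
    unfolding g_def using line[of s "t *\<^sub>R b"] line[of s 0] in_ball[of s t] in_ball[of s 0] that t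
    by (auto intro!: derivative_eq_intros)
  obtain \<xi> where \<xi>: "0 < \<xi>" "\<xi> < t"
    and g: "g t - g 0 = (t - 0) * (frechet_derivative f (at (x + \<xi> *\<^sub>R a + t *\<^sub>R b)) a
      - frechet_derivative f (at (x + \<xi> *\<^sub>R a)) a)"
    using MVT2[OF t(1) dg] by blast
  define h where "h r = frechet_derivative f (at (x + \<xi> *\<^sub>R a + r *\<^sub>R b)) a" for r
  have dh: "(h has_real_derivative
      frechet_derivative (\<lambda>z. frechet_derivative f (at z) a) (at (x + \<xi> *\<^sub>R a + r *\<^sub>R b)) b) (at r)"
    if "0 \<le> r" "r \<le> t" for r
    unfolding h_def using f'[OF in_ball[of \<xi> r]] \<xi> that by (intro has_real_derivative_along_line) simp
  obtain \<eta> where \<eta>: "0 < \<eta>" "\<eta> < t"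
    and h: "h t - h 0 = (t - 0) *
      frechet_derivative (\<lambda>z. frechet_derivative f (at z) a) (at (x + \<xi> *\<^sub>R a + \<eta> *\<^sub>R b)) b"
    using MVT2[OF t(1) dh] by blast
  show thesis
    using that[OF \<xi> \<eta>] g h by (simp add: g_def h_def algebra_simps)
qed

lemma frechet_derivative_commute_real:
  fixes f :: "'a::real_normed_vector \<Rightarrow> real"
  assumes "open S" "x \<in> S" "smooth_on f S"
  shows "frechet_derivative (\<lambda>z. frechet_derivative f (at z) a) (at x) b =
         frechet_derivative (\<lambda>z. frechet_derivative f (at z) b) (at x) a"
proof (rule ccontr)
  let ?F = "\<lambda>a b z. frechet_derivative (\<lambda>z. frechet_derivative f (at z) a) (at z) b"
  assume ne: "?F a b x \<noteq> ?F b a x"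
  \<comment> \<open>Half the gap: two numbers closer than this to the two distinct values cannot
    coincide.\<close>
  define \<epsilon> where "\<epsilon> = \<bar>?F a b x - ?F b a x\<bar> / 2"
  have "\<epsilon> > 0" using ne by (simp add: \<epsilon>_def)
  have "isCont (?F a b) x" for a b
    using assms by (auto intro!: continuous_on_interior smooth_on_continuous smooth_on_derivative
        simp: interior_open)
  then have "\<exists>d>0. \<forall>y. dist y x < d \<longrightarrow> \<bar>?F a b y - ?F a b x\<bar> < \<epsilon>" for a b
    using \<open>\<epsilon> > 0\<close> by (simp add: continuous_at_eps_delta dist_real_def)
  then obtain d d' where d: "d > 0" "\<And>y. dist y x < d \<Longrightarrow> \<bar>?F a b y - ?F a b x\<bar> < \<epsilon>"
    and d': "d' > 0" "\<And>y. dist y x < d' \<Longrightarrow> \<bar>?F b a y - ?F b a x\<bar> < \<epsilon>"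
    by meson
  obtain e0 where e0: "e0 > 0" "ball x e0 \<subseteq> S"
    using assms openE by blast
  define e where "e = min e0 (min d d')"
  have e: "e > 0" "ball x e \<subseteq> S" using e0 d d' by (auto simp: e_def)
  \<comment> \<open>The summand 1 keeps the denominator positive when \<open>a = b = 0\<close> and
    makes \<open>t * (norm a + norm b) < e\<close> strict.\<close>
  define t where "t = e / (norm a + norm b + 1)"
  have t: "t > 0" using e by (simp add: t_def add_nonneg_pos)
  have "t * (norm a + norm b + 1) = e"
    using add_nonneg_pos[of "norm a + norm b" 1] by (simp add: t_def)
  then have te: "t * (norm a + norm b) < e" "t * (norm b + norm a) < e"
    using t by (auto simp: algebra_simps)
  have df: "f differentiable at y" "(\<lambda>z. frechet_derivative f (at z) c) differentiable at y"
    if "y \<in> ball x e" for y c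
    using that e(2) smooth_on_differentiable[OF assms(3), of y]
      smooth_on_differentiable[OF smooth_on_derivative[OF assms(3)], of y] by (simp_all add: subset_iff)
  obtain \<xi> \<eta> where 1: "0 < \<xi>" "\<xi> < t" "0 < \<eta>" "\<eta> < t"
    "f (x + t *\<^sub>R a + t *\<^sub>R b) - f (x + t *\<^sub>R a) - f (x + t *\<^sub>R b) + f x =
     t * t * ?F a b (x + \<xi> *\<^sub>R a + \<eta> *\<^sub>R b)"
    by (rule second_difference_mean_value[OF df t te(1)])
  obtain \<xi>' \<eta>' where 2: "0 < \<xi>'" "\<xi>' < t" "0 < \<eta>'" "\<eta>' < t"
    "f (x + t *\<^sub>R b + t *\<^sub>R a) - f (x + t *\<^sub>R b) - f (x + t *\<^sub>R a) + f x =
     t * t * ?F b a (x + \<xi>' *\<^sub>R b + \<eta>' *\<^sub>R a)"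
    by (rule second_difference_mean_value[OF df t te(2)])
  have near: "dist (x + s *\<^sub>R a + r *\<^sub>R b) x < e" if "0 < s" "s < t" "0 < r" "r < t" for s r
  proof -
    have "norm (s *\<^sub>R a + r *\<^sub>R b) \<le> s * norm a + r * norm b"
      using norm_triangle_ineq[of "s *\<^sub>R a" "r *\<^sub>R b"] that by simp
    also have "\<dots> \<le> t * norm a + t * norm b"
      using that by (intro add_mono mult_right_mono) auto
    finally show ?thesis
      using te by (simp add: dist_norm algebra_simps)
  qed
  \<comment> \<open>The second difference is symmetric in \<open>a\<close> and \<open>b\<close>, so
    both mean values equal it divided by \<open>t * t\<close>.\<close>
  have "?F a b (x + \<xi> *\<^sub>R a + \<eta> *\<^sub>R b) = ?F b a (x + \<xi>' *\<^sub>R b + \<eta>' *\<^sub>R a)"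
    using 1(5) 2(5) t by (simp add: algebra_simps)
  moreover have "\<bar>?F a b (x + \<xi> *\<^sub>R a + \<eta> *\<^sub>R b) - ?F a b x\<bar> < \<epsilon>"
    using near[of \<xi> \<eta>] 1 by (intro d) (simp add: e_def)
  moreover have "\<bar>?F b a (x + \<xi>' *\<^sub>R b + \<eta>' *\<^sub>R a) - ?F b a x\<bar> < \<epsilon>"
    using near[of \<eta>' \<xi>'] 2 by (intro d') (simp add: e_def ac_simps)
  ultimately show False unfolding \<epsilon>_def by (simp add: field_simps abs_if split: if_splits)
qed

lemma frechet_derivative_bounded_linear:
  assumes "bounded_linear h" "f differentiable at x"
  shows "frechet_derivative (\<lambda>x. h (f x)) (at x) v = h (frechet_derivative f (at x) v)"
  using bounded_linear.has_derivative[OF assms(1) frechet_derivative_works'[OF assms(2)]]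
    frechet_derivative_at by metis

text \<open>The mean value theorem is scalar, so vector-valued maps are treated through their inner
  products with basis vectors.\<close>

lemma frechet_derivative_commute:
  fixes f :: "'a::real_normed_vector \<Rightarrow> 'b::euclidean_space"
  assumes "open S" "x \<in> S" "smooth_on f S"
  shows "frechet_derivative (\<lambda>z. frechet_derivative f (at z) a) (at x) b =
         frechet_derivative (\<lambda>z. frechet_derivative f (at z) b) (at x) a"
proof (rule euclidean_eqI)
  fix c :: 'b assume "c \<in> Basis"
  have *: "frechet_derivative (\<lambda>z. frechet_derivative f (at z) a) (at x) b \<bullet> c =
      frechet_derivative (\<lambda>z. frechet_derivative (\<lambda>z. f z \<bullet> c) (at z) a) (at x) b" for a b
  proof -
    have "frechet_derivative (\<lambda>z. frechet_derivative (\<lambda>z. f z \<bullet> c) (at z) a) (at x) =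
        frechet_derivative (\<lambda>z. frechet_derivative f (at z) a \<bullet> c) (at x)"
      using assms smooth_on_differentiable
      by (intro frechet_derivative_cong_open[OF assms(1,2)]
          frechet_derivative_bounded_linear[OF bounded_linear_inner_left]) blast
    then show ?thesis
      using frechet_derivative_bounded_linear[OF bounded_linear_inner_left, of _ x c]
        smooth_on_differentiable[OF smooth_on_derivative[OF assms(3)] assms(2)]
      by metis
  qed
  show "frechet_derivative (\<lambda>z. frechet_derivative f (at z) a) (at x) b \<bullet> c =
      frechet_derivative (\<lambda>z. frechet_derivative f (at z) b) (at x) a \<bullet> c"
    unfolding *
    by (intro frechet_derivative_commute_real[OF assms(1,2)]
        smooth_on_bounded_linear[OF bounded_linear_inner_left] assms)
qed

subsection \<open>Parametric integrals and the Hadamard lemma\<close>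

text \<open>Differentiating \<open>H (t *\<^sub>R x)\<close> under the integral sign produces one
  more factor \<open>t\<close>. With the weight \<open>t ^ k\<close> in the statement, the
  derivative is again of the same form, with \<open>Suc k\<close> and a directional derivative of
  \<open>H\<close>, so the induction closes. Convexity keeps the segment from 0 to \<open>x\<close>
  inside \<open>S\<close>.\<close>

lemma Ck_on_integral_scaled:
  fixes H :: "'a::euclidean_space \<Rightarrow> real"
  assumes S: "open S" "convex S" "0 \<in> S" and H: "Ck_on n H S"
  shows "Ck_on n (\<lambda>x. integral {0..1} (\<lambda>t. t ^ k * H (t *\<^sub>R x))) S"
proof -
  have mem: "t *\<^sub>R x \<in> S" if "x \<in> S" "t \<in> {0..1}" for x and t :: real
    using convexD[OF S(2) that(1) S(3), of t "1 - t"] that(2) by simp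
  have cont: "continuous_on (Sigma S (\<lambda>_. cbox (0::real) 1)) (\<lambda>(x, t). t ^ k * G (t *\<^sub>R x))"
    if "continuous_on S G" for G :: "'a \<Rightarrow> real" and k
  proof -
    have "continuous_on (Sigma S (\<lambda>_. cbox (0::real) 1)) (\<lambda>z. G (snd z *\<^sub>R fst z))"
      by (rule continuous_on_compose2[OF that]) (auto intro!: continuous_intros mem)
    then show ?thesis
      by (auto intro!: continuous_intros simp: case_prod_unfold)
  qed
  have cont1: "continuous_on {0..1} (\<lambda>t. t ^ k * G (t *\<^sub>R x))"
    if "continuous_on S G" "x \<in> S" for G :: "'a \<Rightarrow> real" and k x
  proof -
    have "continuous_on {0..1} (\<lambda>t. G (t *\<^sub>R x))"
      by (rule continuous_on_compose2[OF that(1)]) (auto intro!: continuous_intros mem that(2))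
    then show ?thesis
      by (intro continuous_intros)
  qed
  show ?thesis
    using H
  proof (induction n arbitrary: H k)
    case 0
    then show ?case
      using integral_continuous_on_param[OF cont[of H k]] by (simp add: cbox_interval)
  next
    case (Suc n)
    have H: "H differentiable at x" if "x \<in> S" for x
      using Suc.prems that by simp
    have H0: "continuous_on S H"
      using H by (auto intro!: differentiable_imp_continuous_within continuous_at_imp_continuous_on)
    have "Ck_on n (\<lambda>x. frechet_derivative H (at x) v) S" for v
      using Suc.prems by simp
    then have DH: "continuous_on S (\<lambda>x. frechet_derivative H (at x) v)" for v
    proof (induction n)
      case (Suc n)
      then show ?case by (metis Ck_on_SucD)
    qed simp
    let ?D = "\<lambda>x v. integral {0..1} (\<lambda>t. t ^ Suc k * frechet_derivative H (at (t *\<^sub>R x)) v)"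
    \<comment> \<open>Leibniz's rule asks for the derivative as a \<open>blinfun\<close> depending
      continuously on \<open>(x, t)\<close>; in finite dimension this continuity can be checked on
      basis vectors.\<close>
    define B where "B x t = Blinfun (\<lambda>v. t ^ Suc k * frechet_derivative H (at (t *\<^sub>R x)) v)"
      for x and t :: real
    have B: "blinfun_apply (B x t) = (\<lambda>v. t ^ Suc k * frechet_derivative H (at (t *\<^sub>R x)) v)"
      if "x \<in> S" "t \<in> {0..1}" for x t
      unfolding B_def using H[OF mem[OF that]] frechet_derivative_works has_derivative_bounded_linear
      by (intro bounded_linear_Blinfun_apply bounded_linear_const_mult) blast
    show ?case
    proof (rule Ck_on_SucI[OF S(1), where D = ?D])
      show "Ck_on n (\<lambda>x. ?D x v) S" for v
        using Suc.prems by (intro Suc.IH) simp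
    next
      fix x assume x: "x \<in> S"
      have contB: "continuous_on (Sigma S (\<lambda>_. cbox (0::real) 1)) (\<lambda>(x, t). B x t)"
      proof (rule continuous_on_blinfun_componentwise)
        fix i :: 'a
        have "continuous_on (Sigma S (\<lambda>_. cbox (0::real) 1))
          (\<lambda>(x, t). t ^ Suc k * frechet_derivative H (at (t *\<^sub>R x)) i)"
          by (rule cont[OF DH])
        then show "continuous_on (Sigma S (\<lambda>_. cbox (0::real) 1))
          (\<lambda>z. blinfun_apply (case z of (x, t) \<Rightarrow> B x t) i)"
          by (rule continuous_on_cong[THEN iffD1, rotated -1]) (auto simp: B cbox_interval)
      qed
      have der: "((\<lambda>x. t ^ k * H (t *\<^sub>R x)) has_derivative blinfun_apply (B x t)) (at x within S)"
        if "x \<in> S" "t \<in> cbox 0 1" for x t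
      proof -
        have t: "t \<in> {0..1}" using that by (simp add: cbox_interval)
        have "((\<lambda>x. H (t *\<^sub>R x)) has_derivative (\<lambda>v. frechet_derivative H (at (t *\<^sub>R x)) (t *\<^sub>R v))) (at x)"
          by (rule has_derivative_compose[where g = H])
             (auto intro!: derivative_eq_intros frechet_derivative_works' H mem that(1) t)
        then have "((\<lambda>x. t ^ k * H (t *\<^sub>R x)) has_derivative
            (\<lambda>v. t ^ k * frechet_derivative H (at (t *\<^sub>R x)) (t *\<^sub>R v))) (at x)"
          by (rule has_derivative_mult_right)
        moreover have "(\<lambda>v. t ^ k * frechet_derivative H (at (t *\<^sub>R x)) (t *\<^sub>R v)) = blinfun_apply (B x t)"
          using linear_cmul[OF linear_frechet_derivative[OF H[OF mem[OF that(1) t]]]]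
          by (simp add: B[OF that(1) t] mult_ac)
        ultimately show ?thesis by (simp add: has_derivative_at_withinI)
      qed
      have int: "(\<lambda>t. t ^ k * H (t *\<^sub>R x)) integrable_on cbox 0 1" if "x \<in> S" for x
        using cont1[OF H0 that, of k] by (simp add: integrable_continuous_real cbox_interval)
      have "((\<lambda>x. integral (cbox 0 1) (\<lambda>t. t ^ k * H (t *\<^sub>R x))) has_derivative
          integral (cbox 0 1) (B x)) (at x within S)"
        by (rule leibniz_rule[OF der int contB x S(2)])
      moreover have "blinfun_apply (integral (cbox 0 1) (B x)) = ?D x"
      proof
        fix v
        have "continuous_on (cbox 0 1) (B x)"
          using continuous_on_compose2[OF contB, of "cbox 0 1" "\<lambda>t. (x, t)"] x
          by (simp add: continuous_on_Pair image_subset_iff)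
        then have "blinfun_apply (integral (cbox 0 1) (B x)) v =
            integral (cbox 0 1) (\<lambda>t. blinfun_apply (B x t) v)"
          by (intro blinfun_apply_integral integrable_continuous)
        also have "\<dots> = ?D x v"
          unfolding cbox_interval by (intro integral_cong) (simp add: B x)
        finally show "blinfun_apply (integral (cbox 0 1) (B x)) v = ?D x v" .
      qed
      ultimately show "((\<lambda>x. integral {0..1} (\<lambda>t. t ^ k * H (t *\<^sub>R x))) has_derivative ?D x) (at x)"
        by (simp only: cbox_interval at_within_open[OF x S(1)])
    qed
  qed
qed

lemma frechet_derivative_plane:
  fixes f :: "real^2 \<Rightarrow> 'b::real_normed_vector"
  assumes "f differentiable at q"
  shows "frechet_derivative f (at q) v = v $ 1 *\<^sub>R pderiv_at 1 f q + v $ 2 *\<^sub>R pderiv_at 2 f q"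
proof -
  have "v = v $ 1 *\<^sub>R axis 1 1 + v $ 2 *\<^sub>R axis 2 1"
    by (simp add: vec_eq_iff forall_2 axis_def)
  then have "frechet_derivative f (at q) v =
      frechet_derivative f (at q) (v $ 1 *\<^sub>R axis 1 1 + v $ 2 *\<^sub>R axis 2 1)" by simp
  also have "\<dots> = v $ 1 *\<^sub>R pderiv_at 1 f q + v $ 2 *\<^sub>R pderiv_at 2 f q"
    using linear_frechet_derivative[OF assms] by (simp add: linear_add linear_cmul pderiv_at_def)
  finally show ?thesis .
qed

lemma smooth_on_pderiv: "smooth_on f S \<Longrightarrow> smooth_on (pderiv_at i f) S"
  using smooth_on_derivative[of f S "axis i 1"] unfolding pderiv_at_def .

lemma smooth_on_translation:
  fixes f :: "'a::euclidean_space \<Rightarrow> 'b::real_normed_vector"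
  assumes "smooth_on f (ball p e)"
  shows "smooth_on (\<lambda>x. f (p + x)) (ball 0 e)"
  by (rule smooth_on_compose[OF open_ball open_ball _ _ assms])
     (simp_all add: dist_norm smooth_on_add smooth_on_const smooth_on_ident)

text \<open>Integrate d/dt h(p + t x) over [0,1]. The cofactors are the averages of the partial
  derivatives along the segment, which explains both their smoothness and their values at 0.\<close>

lemma Hadamard_plane:
  fixes h :: "real^2 \<Rightarrow> real"
  assumes h: "smooth_on h (ball p e)" and "e > 0" "h p = 0"
  obtains g1 g2 where "smooth_on g1 (ball 0 e)" "smooth_on g2 (ball 0 e)"
    "g1 0 = pderiv_at 1 h p" "g2 0 = pderiv_at 2 h p"
    "\<And>x. x \<in> ball 0 e \<Longrightarrow> h (p + x) = x $ 1 * g1 x + x $ 2 * g2 x"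
proof -
  \<comment> \<open>The factor \<open>t ^ 0\<close> matches the case \<open>k = 0\<close> of
    \<open>Ck_on_integral_scaled\<close>.\<close>
  define g where "g i x = integral {0..1} (\<lambda>t. t ^ 0 * pderiv_at i h (p + t *\<^sub>R x))" for i x
  have sm: "smooth_on (\<lambda>x. pderiv_at i h (p + x)) (ball 0 e)" for i
    by (intro smooth_on_translation smooth_on_pderiv h)
  have 1: "smooth_on (g i) (ball 0 e)" for i
    unfolding smooth_on_def g_def
  proof
    fix n
    show "Ck_on n (\<lambda>x. integral {0..1} (\<lambda>t. t ^ 0 * pderiv_at i h (p + t *\<^sub>R x))) (ball 0 e)"
      by (rule Ck_on_integral_scaled[where H = "\<lambda>x. pderiv_at i h (p + x)"])
         (use sm[of i] \<open>e > 0\<close> in \<open>simp_all add: smooth_on_def\<close>)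
  qed
  have 2: "g i 0 = pderiv_at i h p" for i
    by (simp add: g_def)
  have 3: "h (p + x) = x $ 1 * g 1 x + x $ 2 * g 2 x" if x: "x \<in> ball 0 e" for x
  proof -
    have mem: "t *\<^sub>R x \<in> ball 0 e" if "t \<in> {0..1}" for t :: real
    proof -
      have "norm (t *\<^sub>R x) \<le> 1 * norm x" unfolding norm_scaleR using that by (intro mult_right_mono) auto
      then show ?thesis using x by simp
    qed
    have mem': "p + t *\<^sub>R x \<in> ball p e" if "t \<in> {0..1}" for t :: real
      using mem[OF that] by (simp add: dist_norm)
    have dh: "h differentiable at (p + t *\<^sub>R x)" if "t \<in> {0..1}" for t :: real
      using smooth_on_differentiable[OF h mem'[OF that]] .
    have I: "((\<lambda>t. frechet_derivative h (at (p + t *\<^sub>R x)) x) has_integral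
        h (p + 1 *\<^sub>R x) - h (p + 0 *\<^sub>R x)) {0..1}"
    proof (rule fundamental_theorem_of_calculus)
      fix t :: real assume "t \<in> {0..1}"
      from has_real_derivative_along_line[OF dh[OF this]]
      show "((\<lambda>t. h (p + t *\<^sub>R x)) has_vector_derivative frechet_derivative h (at (p + t *\<^sub>R x)) x)
          (at t within {0..1})"
        by (simp add: has_real_derivative_iff_has_vector_derivative has_vector_derivative_at_within)
    qed simp
    have "((\<lambda>t. x $ i * pderiv_at i h (p + t *\<^sub>R x)) has_integral x $ i * g i x) {0..1}" for i
    proof (intro has_integral_mult_right)
      have "continuous_on {0..1} (\<lambda>t. pderiv_at i h (p + t *\<^sub>R x))"
        by (rule continuous_on_compose2[OF smooth_on_continuous[OF sm[of i]]])
           (use mem in \<open>auto intro!: continuous_intros\<close>)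
      then show "((\<lambda>t. pderiv_at i h (p + t *\<^sub>R x)) has_integral g i x) {0..1}"
        unfolding g_def by (simp add: integrable_integral integrable_continuous_real)
    qed
    then have "((\<lambda>t. x $ 1 * pderiv_at 1 h (p + t *\<^sub>R x) + x $ 2 * pderiv_at 2 h (p + t *\<^sub>R x))
        has_integral x $ 1 * g 1 x + x $ 2 * g 2 x) {0..1}"
      by (intro has_integral_add)
    then have "((\<lambda>t. frechet_derivative h (at (p + t *\<^sub>R x)) x)
        has_integral x $ 1 * g 1 x + x $ 2 * g 2 x) {0..1}"
      by (rule has_integral_eq[rotated]) (simp add: frechet_derivative_plane dh)
    from has_integral_unique[OF I this] show ?thesis
      using \<open>h p = 0\<close> by simp
  qed
  show thesis
    by (rule that[OF 1 1 2 2 3])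
qed

subsection \<open>Surfaces with a unit normal field\<close>

lemma pderiv_at_bilinear:
  assumes "bounded_bilinear h" "f differentiable at q" "g differentiable at q"
  shows "pderiv_at i (\<lambda>x. h (f x) (g x)) q = h (f q) (pderiv_at i g q) + h (pderiv_at i f q) (g q)"
proof -
  have "((\<lambda>x. h (f x) (g x)) has_derivative
      (\<lambda>v. h (f q) (frechet_derivative g (at q) v) + h (frechet_derivative f (at q) v) (g q))) (at q)"
    by (intro bounded_bilinear.FDERIV[OF assms(1)] frechet_derivative_works' assms)
  from frechet_derivative_at[OF this, symmetric] show ?thesis
    unfolding pderiv_at_def by simp
qed

lemmas pderiv_at_inner = pderiv_at_bilinear[OF bounded_bilinear_inner]
lemmas pderiv_at_mult = pderiv_at_bilinear[OF bounded_bilinear_mult]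

lemma pderiv_at_add:
  assumes "f differentiable at q" "g differentiable at q"
  shows "pderiv_at i (\<lambda>x. f x + g x) q = pderiv_at i f q + pderiv_at i g q"
  using frechet_derivative_at[OF has_derivative_add[OF assms[THEN frechet_derivative_works']], symmetric]
  unfolding pderiv_at_def by simp

lemma pderiv_at_cong:
  assumes "open S" "q \<in> S" "\<And>x. x \<in> S \<Longrightarrow> f x = g x"
  shows "pderiv_at i f q = pderiv_at i g q"
  unfolding pderiv_at_def using frechet_derivative_cong_open[OF assms] by simp

lemma pderiv_at_commute:
  fixes f :: "real^2 \<Rightarrow> 'b::euclidean_space"
  assumes "open S" "q \<in> S" "smooth_on f S"
  shows "pderiv_at i (pderiv_at j f) q = pderiv_at j (pderiv_at i f) q"
proof -
  have "pderiv_at k f = (\<lambda>z. frechet_derivative f (at z) (axis k 1))" for k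
    by (simp add: pderiv_at_def fun_eq_iff)
  then show ?thesis
    using frechet_derivative_commute[OF assms, of "axis j 1" "axis i 1"]
    by (simp add: pderiv_at_def)
qed

section \<open>Cross products, immersions and inverse 2 by 2 matrices\<close>

lemma bounded_bilinear_cross3: "bounded_bilinear cross3"
  using bilinear_cross bilinear_conv_bounded_bilinear by blast

lemma eq_inner_scaleR_normal:
  fixes w n :: "real^3"
  assumes "cross3 n w = 0" "norm n = 1"
  shows "w = (w \<bullet> n) *\<^sub>R n"
  using Lagrange[of n n w] assms by (simp add: inner_commute dot_square_norm)

text \<open>Lagrange's formula gives n x (x x y) = 0, so only the component along \<open>n\<close>
  is left. This converts non-vanishing cross products of partial derivatives into non-vanishing
  determinants, for \<open>f\<close> and for \<open>\<nu>\<close> alike.\<close>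

lemma cross3_eq_scaleR_normal:
  fixes x y n :: "real^3"
  assumes "x \<bullet> n = 0" "y \<bullet> n = 0" "norm n = 1"
  shows "cross3 x y = det (vector [x, y, n]) *\<^sub>R n"
proof -
  have "cross3 n (cross3 x y) = 0"
    using Lagrange[of n x y] assms by (simp add: inner_commute)
  moreover have "cross3 x y \<bullet> n = det (vector [x, y, n])"
    using cross_triple[of x y n] dot_cross_det[of x y n] by (simp add: inner_commute)
  ultimately show ?thesis
    using eq_inner_scaleR_normal[of n "cross3 x y"] assms(3) by simp
qed

lemma immersion_at_iff_cross3:
  fixes h :: "real^2 \<Rightarrow> real^3"
  assumes "h differentiable at q"
  shows "immersion_at h q \<longleftrightarrow> cross3 (pderiv_at 1 h q) (pderiv_at 2 h q) \<noteq> 0"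
proof -
  let ?x = "pderiv_at 1 h q" and ?y = "pderiv_at 2 h q"
  have inj: "immersion_at h q \<longleftrightarrow> (\<forall>v::real^2. v $ 1 *\<^sub>R ?x + v $ 2 *\<^sub>R ?y = 0 \<longrightarrow> v = 0)"
    unfolding immersion_at_def linear_injective_0[OF linear_frechet_derivative[OF assms]]
    by (simp add: frechet_derivative_plane[OF assms])
  show ?thesis
  proof
    assume imm: "immersion_at h q"
    show "cross3 ?x ?y \<noteq> 0"
    proof
      assume "cross3 ?x ?y = 0"
      then consider "?x = 0" | "?y = 0" | c where "?y = c *\<^sub>R ?x"
        unfolding cross_eq_0 collinear_lemma by blast
      then have "\<exists>v::real^2. v $ 1 *\<^sub>R ?x + v $ 2 *\<^sub>R ?y = 0 \<and> v \<noteq> 0"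
      proof cases
        case 1 then show ?thesis by (intro exI[of _ "axis 1 1"]) (simp add: axis_def vec_eq_iff forall_2)
      next
        case 2 then show ?thesis by (intro exI[of _ "axis 2 1"]) (simp add: axis_def vec_eq_iff forall_2)
      next
        case 3 then show ?thesis by (intro exI[of _ "vector [- c, 1]"]) (simp add: vec_eq_iff forall_2)
      qed
      then show False using imm inj by blast
    qed
  next
    assume ne: "cross3 ?x ?y \<noteq> 0"
    show "immersion_at h q"
      unfolding inj
    proof (intro allI impI)
      fix v :: "real^2" assume v: "v $ 1 *\<^sub>R ?x + v $ 2 *\<^sub>R ?y = 0"
      \<comment> \<open>Crossing the combination with one partial derivative isolates the
        coefficient of the other.\<close>
      have "v $ 1 *\<^sub>R cross3 ?x ?y = cross3 (v $ 1 *\<^sub>R ?x + v $ 2 *\<^sub>R ?y) ?y"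
        "v $ 2 *\<^sub>R cross3 ?x ?y = cross3 ?x (v $ 1 *\<^sub>R ?x + v $ 2 *\<^sub>R ?y)"
        by (simp_all add: cross_add_left cross_add_right cross_mult_left cross_mult_right)
      then have "v $ 1 = 0" "v $ 2 = 0" using ne unfolding v by simp_all
      then show "v = 0" by (simp add: vec_eq_iff forall_2)
    qed
  qed
qed

lemma matrix_inv_2:
  fixes A :: "real^2^2"
  assumes "det A \<noteq> 0"
  shows "matrix_inv A $ 1 $ 1 = A $ 2 $ 2 / det A" "matrix_inv A $ 1 $ 2 = - A $ 1 $ 2 / det A"
    "matrix_inv A $ 2 $ 1 = - A $ 2 $ 1 / det A" "matrix_inv A $ 2 $ 2 = A $ 1 $ 1 / det A"
proof -
  define B :: "real^2^2" where "B = vector [vector [A $ 2 $ 2 / det A, - A $ 1 $ 2 / det A],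
    vector [- A $ 2 $ 1 / det A, A $ 1 $ 1 / det A]]"
  have "A ** B = mat 1"
    using assms by (simp add: B_def matrix_matrix_mult_def mat_def vec_eq_iff forall_2 sum_2 field_simps)
      (simp add: det_2 algebra_simps)
  moreover have "matrix_inv A ** A = mat 1"
    using someI_ex[of "\<lambda>A'. A ** A' = mat 1 \<and> A' ** A = mat 1"] assms
    by (auto simp: matrix_inv_def invertible_def simp flip: invertible_det_nz)
  ultimately have "matrix_inv A = B"
    by (metis matrix_mul_assoc matrix_mul_lid matrix_mul_rid)
  then show "matrix_inv A $ 1 $ 1 = A $ 2 $ 2 / det A" "matrix_inv A $ 1 $ 2 = - A $ 1 $ 2 / det A"
    "matrix_inv A $ 2 $ 1 = - A $ 2 $ 1 / det A" "matrix_inv A $ 2 $ 2 = A $ 1 $ 1 / det A"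
    by (simp_all add: B_def)
qed

text \<open>The setting of a frontal with a chosen unit normal; the front condition enters later, in
  \<open>front_kernel\<close>.\<close>

locale surface_with_normal =
  fixes V :: "(real^2) set" and f \<nu> :: "real^2 \<Rightarrow> real^3"
  assumes open_V: "open V" and smooth_f: "smooth_on f V" and normal: "unit_normal_field V f \<nu>"
begin

abbreviation "f\<^sub>1 i \<equiv> pderiv_at i f"
abbreviation "f\<^sub>2 i j \<equiv> pderiv_at i (pderiv_at j f)"
abbreviation "\<nu>\<^sub>1 i \<equiv> pderiv_at i \<nu>"
abbreviation "\<Lambda> \<equiv> signed_area_density f \<nu>"
text \<open>The Jacobian of the Gauss map: a map into the unit sphere is normal to its own
  derivative, so \<open>\<nu>\<close> serves both as the surface and as its normal.\<close>

abbreviation "\<mu> \<equiv> signed_area_density \<nu> \<nu>"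

lemma smooth_\<nu>: "smooth_on \<nu> V"
  and norm_\<nu>: "q \<in> V \<Longrightarrow> norm (\<nu> q) = 1"
  and df_orthogonal_\<nu>: "q \<in> V \<Longrightarrow> frechet_derivative f (at q) a \<bullet> \<nu> q = 0"
  using normal unfolding unit_normal_field_def by auto

lemma \<nu>_unit: "q \<in> V \<Longrightarrow> \<nu> q \<bullet> \<nu> q = 1"
  by (simp add: norm_\<nu> dot_square_norm)

lemmas smooth_f\<^sub>1 = smooth_on_pderiv[OF smooth_f]
lemmas smooth_f\<^sub>2 = smooth_on_pderiv[OF smooth_f\<^sub>1]

lemma f\<^sub>1_orthogonal_\<nu>: "q \<in> V \<Longrightarrow> f\<^sub>1 i q \<bullet> \<nu> q = 0"
  unfolding pderiv_at_def by (rule df_orthogonal_\<nu>)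

lemma \<nu>\<^sub>1_orthogonal_\<nu>:
  assumes "q \<in> V" shows "\<nu>\<^sub>1 i q \<bullet> \<nu> q = 0"
proof -
  have "pderiv_at i (\<lambda>x. \<nu> x \<bullet> \<nu> x) q = pderiv_at i (\<lambda>x. 1) q"
    by (rule pderiv_at_cong[OF open_V assms]) (rule \<nu>_unit)
  also have "\<dots> = (0::real)" by (simp add: pderiv_at_def)
  finally show ?thesis
    using smooth_on_differentiable[OF smooth_\<nu> assms] by (simp add: pderiv_at_inner inner_commute)
qed

lemma f\<^sub>2_dot_\<nu>:
  assumes "q \<in> V" shows "f\<^sub>2 i j q \<bullet> \<nu> q = - (f\<^sub>1 j q \<bullet> \<nu>\<^sub>1 i q)"
proof -
  have "pderiv_at i (\<lambda>x. f\<^sub>1 j x \<bullet> \<nu> x) q = pderiv_at i (\<lambda>x. 0) q"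
    by (rule pderiv_at_cong[OF open_V assms]) (rule f\<^sub>1_orthogonal_\<nu>)
  also have "\<dots> = (0::real)" by (simp add: pderiv_at_def)
  finally show ?thesis
    using smooth_on_differentiable[OF smooth_\<nu> assms] smooth_on_differentiable[OF smooth_f\<^sub>1 assms]
    by (simp add: pderiv_at_inner)
qed

lemmas f\<^sub>2_commute = pderiv_at_commute[OF open_V _ smooth_f]

text \<open>Symmetry of the second fundamental form. It comes from commuting second derivatives of
  \<open>f\<close> and not from the metric, so it is available at singular points too.\<close>

lemma f\<^sub>1_dot_\<nu>\<^sub>1_commute: "q \<in> V \<Longrightarrow> f\<^sub>1 j q \<bullet> \<nu>\<^sub>1 i q = f\<^sub>1 i q \<bullet> \<nu>\<^sub>1 j q"
  using f\<^sub>2_dot_\<nu>[of q i j] f\<^sub>2_dot_\<nu>[of q j i] f\<^sub>2_commute[of q i j] by simp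

lemma df_dot_d\<nu>_commute:
  assumes "q \<in> V"
  shows "frechet_derivative f (at q) a \<bullet> frechet_derivative \<nu> (at q) b =
         frechet_derivative f (at q) b \<bullet> frechet_derivative \<nu> (at q) a"
  using f\<^sub>1_dot_\<nu>\<^sub>1_commute[OF assms, of 1 2]
  by (simp add: frechet_derivative_plane smooth_on_differentiable[OF smooth_f assms]
      smooth_on_differentiable[OF smooth_\<nu> assms] inner_simps algebra_simps)

lemma cross3_f\<^sub>1: "q \<in> V \<Longrightarrow> cross3 (f\<^sub>1 1 q) (f\<^sub>1 2 q) = \<Lambda> q *\<^sub>R \<nu> q"
  unfolding signed_area_density_def by (intro cross3_eq_scaleR_normal f\<^sub>1_orthogonal_\<nu> norm_\<nu>)

lemma cross3_\<nu>\<^sub>1: "q \<in> V \<Longrightarrow> cross3 (\<nu>\<^sub>1 1 q) (\<nu>\<^sub>1 2 q) = \<mu> q *\<^sub>R \<nu> q"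
  unfolding signed_area_density_def by (intro cross3_eq_scaleR_normal \<nu>\<^sub>1_orthogonal_\<nu> norm_\<nu>)

lemma \<nu>_nonzero: "q \<in> V \<Longrightarrow> \<nu> q \<noteq> 0"
  using norm_\<nu>[of q] by auto

lemma immersion_f_iff: "q \<in> V \<Longrightarrow> immersion_at f q \<longleftrightarrow> \<Lambda> q \<noteq> 0"
  using immersion_at_iff_cross3[OF smooth_on_differentiable[OF smooth_f]] by (simp add: cross3_f\<^sub>1 \<nu>_nonzero)

lemma immersion_\<nu>_iff: "q \<in> V \<Longrightarrow> immersion_at \<nu> q \<longleftrightarrow> \<mu> q \<noteq> 0"
  using immersion_at_iff_cross3[OF smooth_on_differentiable[OF smooth_\<nu>]] by (simp add: cross3_\<nu>\<^sub>1 \<nu>_nonzero)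

lemma smooth_on_signed_area_density:
  fixes h :: "real^2 \<Rightarrow> real^3"
  assumes "smooth_on h V"
  shows "smooth_on (signed_area_density h \<nu>) V"
proof -
  have "smooth_on (\<lambda>q. pderiv_at 1 h q \<bullet> cross3 (pderiv_at 2 h q) (\<nu> q)) V"
    by (intro smooth_on_inner smooth_on_bilinear[OF bounded_bilinear_cross3] open_V smooth_on_pderiv assms smooth_\<nu>)
  then show ?thesis
    by (simp add: signed_area_density_def[abs_def] dot_cross_det)
qed

lemmas smooth_\<Lambda> = smooth_on_signed_area_density[OF smooth_f]
lemmas smooth_\<mu> = smooth_on_signed_area_density[OF smooth_\<nu>]

section \<open>Christoffel symbols and the Gauss equation on the regular set\<close>

abbreviation "regular \<equiv> {q \<in> V. \<Lambda> q \<noteq> 0}"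
abbreviation "g \<equiv> induced_metric f"

lemma open_regular: "open regular"
proof -
  have "open (V \<inter> \<Lambda> -` (- {0}))"
    using smooth_on_continuous[OF smooth_\<Lambda>] open_V by (intro continuous_open_preimage) auto
  moreover have "V \<inter> \<Lambda> -` (- {0}) = regular" by auto
  ultimately show ?thesis by simp
qed

lemma metric_eq: "g q $ i $ j = f\<^sub>1 i q \<bullet> f\<^sub>1 j q"
  by (simp add: induced_metric_def)

text \<open>Lagrange's identity: the Gram determinant is the squared norm of the cross product,
  which is \<open>\<Lambda> q\<close> times a unit vector.\<close>

lemma det_metric: "q \<in> V \<Longrightarrow> det (g q) = (\<Lambda> q)\<^sup>2"
  using dot_cross[of "f\<^sub>1 1 q" "f\<^sub>1 2 q" "f\<^sub>1 1 q" "f\<^sub>1 2 q"]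
  by (simp add: cross3_f\<^sub>1 \<nu>_unit det_2 metric_eq power2_eq_square)

text \<open>Of the six product rule terms in the three metric derivatives, four cancel because
  second derivatives commute; the other two coincide.\<close>

lemma christoffel_eq:
  assumes "q \<in> V"
  shows "christoffel g k i j q = (\<Sum>l\<in>UNIV. matrix_inv (g q) $ k $ l * (f\<^sub>2 i j q \<bullet> f\<^sub>1 l q))"
proof -
  have d: "pderiv_at a (\<lambda>x. g x $ b $ c) q = f\<^sub>1 b q \<bullet> f\<^sub>2 a c q + f\<^sub>2 a b q \<bullet> f\<^sub>1 c q" for a b c
    unfolding metric_eq by (intro pderiv_at_inner smooth_on_differentiable[OF smooth_f\<^sub>1] assms)
  have "pderiv_at i (\<lambda>x. g x $ j $ l) q + pderiv_at j (\<lambda>x. g x $ i $ l) q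
      - pderiv_at l (\<lambda>x. g x $ i $ j) q = 2 * (f\<^sub>2 i j q \<bullet> f\<^sub>1 l q)" for l
    unfolding d using f\<^sub>2_commute[OF assms, of i j] f\<^sub>2_commute[OF assms, of i l] f\<^sub>2_commute[OF assms, of j l]
    by (simp add: inner_commute)
  then show ?thesis
    unfolding christoffel_def by (simp add: sum_2)
qed

text \<open>Makes the Christoffel symbols differentiable, as the curvature tensor requires; the
  explicit inverse has denominator \<open>(\<Lambda> q)\<^sup>2\<close>, non-zero on
  \<open>regular\<close>.\<close>

lemma smooth_christoffel: "smooth_on (christoffel g k i j) regular"
proof -
  have sm: "smooth_on (f\<^sub>1 l) regular" "smooth_on (f\<^sub>2 i j) regular" "smooth_on \<Lambda> regular" for l
    by (auto intro: smooth_on_subset[OF smooth_f\<^sub>1] smooth_on_subset[OF smooth_f\<^sub>2]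
        smooth_on_subset[OF smooth_\<Lambda>])
  have smg: "smooth_on (\<lambda>q. g q $ a $ b / det (g q)) regular" for a b
  proof -
    have "smooth_on (\<lambda>q. (f\<^sub>1 a q \<bullet> f\<^sub>1 b q) / (\<Lambda> q * \<Lambda> q)) regular"
      by (intro smooth_on_divide smooth_on_inner smooth_on_mult open_regular sm) simp
    then show ?thesis
      by (rule smooth_on_cong[OF open_regular]) (simp add: metric_eq det_metric power2_eq_square)
  qed
  have nz: "det (g q) \<noteq> 0" if "q \<in> regular" for q
    using that by (simp add: det_metric)
  have "smooth_on (\<lambda>q. matrix_inv (g q) $ 1 $ 1) regular"
    "smooth_on (\<lambda>q. matrix_inv (g q) $ 1 $ 2) regular"
    "smooth_on (\<lambda>q. matrix_inv (g q) $ 2 $ 1) regular"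
    "smooth_on (\<lambda>q. matrix_inv (g q) $ 2 $ 2) regular"
    using smooth_on_cong[OF open_regular smg[of 2 2]]
      smooth_on_cong[OF open_regular smooth_on_minus[OF open_regular smg[of 1 2]]]
      smooth_on_cong[OF open_regular smooth_on_minus[OF open_regular smg[of 2 1]]]
      smooth_on_cong[OF open_regular smg[of 1 1]]
    by (simp_all add: matrix_inv_2[OF nz])
  then have inv: "smooth_on (\<lambda>q. matrix_inv (g q) $ a $ b) regular" for a b
    using exhaust_2[of a] exhaust_2[of b] by auto
  have "smooth_on (\<lambda>q. matrix_inv (g q) $ k $ 1 * (f\<^sub>2 i j q \<bullet> f\<^sub>1 1 q)
      + matrix_inv (g q) $ k $ 2 * (f\<^sub>2 i j q \<bullet> f\<^sub>1 2 q)) regular"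
    by (intro smooth_on_add smooth_on_mult smooth_on_inner open_regular inv sm)
  then show ?thesis
    by (rule smooth_on_cong[OF open_regular]) (simp add: christoffel_eq sum_2)
qed

text \<open>Lowering the upper index cancels the inverse metric. In other words, the Christoffel
  symbols are the coefficients of the tangential part of \<open>f\<^sub>2 i j\<close>.\<close>

lemma christoffel_contract:
  assumes "q \<in> regular"
  shows "christoffel g 1 i j q * (f\<^sub>1 1 q \<bullet> f\<^sub>1 m q) + christoffel g 2 i j q * (f\<^sub>1 2 q \<bullet> f\<^sub>1 m q)
    = f\<^sub>2 i j q \<bullet> f\<^sub>1 m q"
proof -
  have q: "q \<in> V" and nz: "det (g q) \<noteq> 0"
    using assms by (simp_all add: det_metric)
  define a b c x y where "a = f\<^sub>1 1 q \<bullet> f\<^sub>1 1 q" and "b = f\<^sub>1 1 q \<bullet> f\<^sub>1 2 q" and "c = f\<^sub>1 2 q \<bullet> f\<^sub>1 2 q"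
    and "x = f\<^sub>2 i j q \<bullet> f\<^sub>1 1 q" and "y = f\<^sub>2 i j q \<bullet> f\<^sub>1 2 q"
  note defs = this
  define d where "d = det (g q)"
  have d: "d = a * c - b * b" "d \<noteq> 0"
    using nz by (simp_all add: d_def det_2 metric_eq defs inner_commute)
  have "christoffel g 1 i j q = (c * x - b * y) / d" "christoffel g 2 i j q = (a * y - b * x) / d"
    using matrix_inv_2[OF nz] unfolding d_def[symmetric]
    by (simp_all add: christoffel_eq[OF q] sum_2 metric_eq defs inner_commute diff_divide_distrib)
  moreover have "(c * x - b * y) / d * a + (a * y - b * x) / d * b = x"
    "(c * x - b * y) / d * b + (a * y - b * x) / d * c = y"
    using d(2) by (simp_all add: field_simps) (simp_all add: d(1) algebra_simps)
  ultimately show ?thesis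
    using exhaust_2[of m] by (auto simp: defs inner_commute)
qed

text \<open>The preceding identity holds on an open set and may be differentiated; solving for the
  terms with derivatives of Christoffel symbols avoids differentiating the inverse metric.\<close>

lemma christoffel_contract_derivative:
  assumes q: "q \<in> regular"
  shows "pderiv_at a (christoffel g 1 i j) q * (f\<^sub>1 1 q \<bullet> f\<^sub>1 m q)
      + pderiv_at a (christoffel g 2 i j) q * (f\<^sub>1 2 q \<bullet> f\<^sub>1 m q)
      = pderiv_at a (f\<^sub>2 i j) q \<bullet> f\<^sub>1 m q + f\<^sub>2 i j q \<bullet> f\<^sub>2 a m q
      - christoffel g 1 i j q * (f\<^sub>1 1 q \<bullet> f\<^sub>2 a m q + f\<^sub>2 a 1 q \<bullet> f\<^sub>1 m q)
      - christoffel g 2 i j q * (f\<^sub>1 2 q \<bullet> f\<^sub>2 a m q + f\<^sub>2 a 2 q \<bullet> f\<^sub>1 m q)"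
proof -
  have V: "q \<in> V" using q by simp
  note diff = smooth_on_differentiable[OF smooth_f\<^sub>1 V] smooth_on_differentiable[OF smooth_f\<^sub>2 V]
    smooth_on_differentiable[OF smooth_christoffel q]
  have diff2: "(\<lambda>x. f\<^sub>1 b x \<bullet> f\<^sub>1 c x) differentiable at q" for b c
    by (rule smooth_on_differentiable[OF smooth_on_inner[OF open_V smooth_f\<^sub>1 smooth_f\<^sub>1] V])
  have diff3: "(\<lambda>x. christoffel g k i j x * (f\<^sub>1 b x \<bullet> f\<^sub>1 c x)) differentiable at q" for k b c
    using differentiable_mult[OF diff(3) diff2] .
  have "pderiv_at a (\<lambda>x. christoffel g 1 i j x * (f\<^sub>1 1 x \<bullet> f\<^sub>1 m x)
      + christoffel g 2 i j x * (f\<^sub>1 2 x \<bullet> f\<^sub>1 m x)) q = pderiv_at a (\<lambda>x. f\<^sub>2 i j x \<bullet> f\<^sub>1 m x) q"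
    by (rule pderiv_at_cong[OF open_regular q christoffel_contract])
  then show ?thesis
    unfolding pderiv_at_add[OF diff3 diff3] pderiv_at_mult[OF diff(3) diff2]
      pderiv_at_inner[OF diff(1) diff(1)] pderiv_at_inner[OF diff(2) diff(1)]
    by (simp add: algebra_simps)
qed

lemma orthogonal_tangent_imp_normal:
  assumes "q \<in> regular" "w \<bullet> f\<^sub>1 1 q = 0" "w \<bullet> f\<^sub>1 2 q = 0"
  shows "w = (w \<bullet> \<nu> q) *\<^sub>R \<nu> q"
proof (rule eq_inner_scaleR_normal)
  have "cross3 w (cross3 (f\<^sub>1 1 q) (f\<^sub>1 2 q)) = 0"
    using assms(2,3) by (simp add: Lagrange)
  then have "cross3 w (\<nu> q) = 0"
    using assms(1) by (simp add: cross3_f\<^sub>1 cross_mult_right)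
  then show "cross3 (\<nu> q) w = 0"
    using cross_skew[of w "\<nu> q"] by simp
  show "norm (\<nu> q) = 1" using assms(1) norm_\<nu> by simp
qed

text \<open>Subtracting the tangential part from \<open>f\<^sub>2 i j\<close> leaves a vector
  orthogonal to both partial derivatives, hence a multiple of \<open>\<nu>\<close>. The arbitrary
  \<open>v\<close> is later taken to be another second derivative.\<close>

lemma Gauss_formula:
  assumes q: "q \<in> regular"
  shows "f\<^sub>2 i j q \<bullet> v - christoffel g 1 i j q * (f\<^sub>1 1 q \<bullet> v) - christoffel g 2 i j q * (f\<^sub>1 2 q \<bullet> v)
    = (f\<^sub>2 i j q \<bullet> \<nu> q) * (\<nu> q \<bullet> v)"
proof -
  define w where "w = f\<^sub>2 i j q - christoffel g 1 i j q *\<^sub>R f\<^sub>1 1 q - christoffel g 2 i j q *\<^sub>R f\<^sub>1 2 q"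
  have "w \<bullet> f\<^sub>1 m q = 0" for m
    using christoffel_contract[OF q, of i j m] by (simp add: w_def inner_simps)
  then have "w = (w \<bullet> \<nu> q) *\<^sub>R \<nu> q"
    by (intro orthogonal_tangent_imp_normal[OF q])
  then have "w \<bullet> v = (w \<bullet> \<nu> q) * (\<nu> q \<bullet> v)"
    by (metis inner_scaleR_left)
  then show ?thesis
    using q by (simp add: w_def inner_simps f\<^sub>1_orthogonal_\<nu>)
qed

text \<open>Theorema Egregium: the intrinsic numerator is the determinant of the second fundamental
  form, which factors as \<open>\<mu> q * \<Lambda> q\<close>; the denominator is
  \<open>(\<Lambda> q)\<^sup>2\<close>.\<close>

theorem gaussian_curvature_eq:
  assumes q: "q \<in> regular"
  shows "gaussian_curvature g q = \<mu> q / \<Lambda> q"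
proof -
  have V: "q \<in> V" using q by simp
  let ?\<Gamma> = "\<lambda>k i j. christoffel g k i j q"
  have third: "pderiv_at 2 (f\<^sub>2 1 2) q = pderiv_at 1 (f\<^sub>2 2 2) q"
    by (rule pderiv_at_commute[OF open_V V smooth_f\<^sub>1])
  have "(\<Sum>l\<in>UNIV. riemann_curvature g l 1 2 2 q * g q $ l $ 1) =
      (pderiv_at 1 (christoffel g 1 2 2) q * (f\<^sub>1 1 q \<bullet> f\<^sub>1 1 q)
        + pderiv_at 1 (christoffel g 2 2 2) q * (f\<^sub>1 2 q \<bullet> f\<^sub>1 1 q))
      - (pderiv_at 2 (christoffel g 1 1 2) q * (f\<^sub>1 1 q \<bullet> f\<^sub>1 1 q)
        + pderiv_at 2 (christoffel g 2 1 2) q * (f\<^sub>1 2 q \<bullet> f\<^sub>1 1 q))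
      + ?\<Gamma> 1 2 2 * (?\<Gamma> 1 1 1 * (f\<^sub>1 1 q \<bullet> f\<^sub>1 1 q) + ?\<Gamma> 2 1 1 * (f\<^sub>1 2 q \<bullet> f\<^sub>1 1 q))
      + ?\<Gamma> 2 2 2 * (?\<Gamma> 1 1 2 * (f\<^sub>1 1 q \<bullet> f\<^sub>1 1 q) + ?\<Gamma> 2 1 2 * (f\<^sub>1 2 q \<bullet> f\<^sub>1 1 q))
      - ?\<Gamma> 1 1 2 * (?\<Gamma> 1 2 1 * (f\<^sub>1 1 q \<bullet> f\<^sub>1 1 q) + ?\<Gamma> 2 2 1 * (f\<^sub>1 2 q \<bullet> f\<^sub>1 1 q))
      - ?\<Gamma> 2 1 2 * (?\<Gamma> 1 2 2 * (f\<^sub>1 1 q \<bullet> f\<^sub>1 1 q) + ?\<Gamma> 2 2 2 * (f\<^sub>1 2 q \<bullet> f\<^sub>1 1 q))"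
    by (simp add: riemann_curvature_def sum_2 metric_eq algebra_simps)
  \<comment> \<open>Third derivatives cancel by \<open>third\<close>, and the products of
    Christoffel symbols cancel half of the product rule terms. What remains is a difference of two
    left sides of \<open>Gauss_formula\<close>.\<close>
  also have "\<dots> = (f\<^sub>2 2 2 q \<bullet> f\<^sub>2 1 1 q - ?\<Gamma> 1 2 2 * (f\<^sub>1 1 q \<bullet> f\<^sub>2 1 1 q) - ?\<Gamma> 2 2 2 * (f\<^sub>1 2 q \<bullet> f\<^sub>2 1 1 q))
      - (f\<^sub>2 1 2 q \<bullet> f\<^sub>2 2 1 q - ?\<Gamma> 1 1 2 * (f\<^sub>1 1 q \<bullet> f\<^sub>2 2 1 q) - ?\<Gamma> 2 1 2 * (f\<^sub>1 2 q \<bullet> f\<^sub>2 2 1 q))"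
    unfolding christoffel_contract_derivative[OF q] christoffel_contract[OF q] third
    by (simp add: algebra_simps)
  also have "\<dots> = (f\<^sub>2 2 2 q \<bullet> \<nu> q) * (f\<^sub>2 1 1 q \<bullet> \<nu> q) - (f\<^sub>2 1 2 q \<bullet> \<nu> q) * (f\<^sub>2 2 1 q \<bullet> \<nu> q)"
    unfolding Gauss_formula[OF q] by (simp add: inner_commute)
  \<comment> \<open>Moving the derivative from \<open>f\<close> to \<open>\<nu>\<close> changes the
    sign of both factors in each product; the rest is the Binet-Cauchy identity
    \<open>dot_cross\<close>.\<close>
  also have "\<dots> = cross3 (\<nu>\<^sub>1 1 q) (\<nu>\<^sub>1 2 q) \<bullet> cross3 (f\<^sub>1 1 q) (f\<^sub>1 2 q)"
    unfolding f\<^sub>2_dot_\<nu>[OF V] dot_cross by (simp add: inner_commute)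
  also have "\<dots> = \<mu> q * \<Lambda> q"
    by (simp add: cross3_f\<^sub>1[OF V] cross3_\<nu>\<^sub>1[OF V] \<nu>_unit[OF V])
  finally show ?thesis
    using q by (simp add: gaussian_curvature_def det_metric power2_eq_square)
qed

lemma smooth_gaussian_curvature: "smooth_on (gaussian_curvature g) regular"
proof -
  have "smooth_on (\<lambda>q. \<mu> q / \<Lambda> q) regular"
    by (intro smooth_on_divide open_regular)
       (auto intro: smooth_on_subset[OF smooth_\<Lambda>] smooth_on_subset[OF smooth_\<mu>])
  then show ?thesis
    by (rule smooth_on_cong[OF open_regular]) (simp add: gaussian_curvature_eq)
qed

end

subsection \<open>Limiting normal curvature and the front condition\<close>

text \<open>Cramer's rule in the basis \<open>a\<close>, \<open>w\<close>.\<close>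

lemma plane_decomposition:
  fixes a v w :: "real^2"
  assumes "a $ 1 * w $ 2 - a $ 2 * w $ 1 \<noteq> 0"
  shows "v = ((v $ 1 * w $ 2 - v $ 2 * w $ 1) / (a $ 1 * w $ 2 - a $ 2 * w $ 1)) *\<^sub>R a
    + ((a $ 1 * v $ 2 - a $ 2 * v $ 1) / (a $ 1 * w $ 2 - a $ 2 * w $ 1)) *\<^sub>R w"
  using assms by (simp add: vec_eq_iff forall_2 add_divide_distrib[symmetric] eq_divide_eq) (simp add: algebra_simps)

text \<open>A vanishing determinant would make \<open>a\<close> a multiple of \<open>w\<close>, and
  \<open>L\<close> would kill it.\<close>

lemma transversal_to_kernel:
  fixes a w :: "real^2"
  assumes "linear L" "L w = 0" "w \<noteq> 0" "L a \<noteq> 0"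
  shows "a $ 1 * w $ 2 - a $ 2 * w $ 1 \<noteq> 0"
proof
  assume eq: "a $ 1 * w $ 2 - a $ 2 * w $ 1 = 0"
  have "(w \<bullet> w) *\<^sub>R a = (a \<bullet> w) *\<^sub>R w"
    using eq by (auto simp: vec_eq_iff forall_2 inner_vec_def sum_2 algebra_simps)
  then have "(w \<bullet> w) *\<^sub>R L a = 0"
    using linear_cmul[OF assms(1)] assms(2) by (metis scaleR_zero_right)
  then show False using assms by simp
qed

context surface_with_normal
begin

text \<open>Write v = r a + t w. The part along \<open>w\<close> drops out of df v, and out of the
  numerator by symmetry of the second fundamental form; the factor r^2 then cancels. This is the
  independence of coordinates behind the limiting normal curvature.\<close>

lemma normal_curvature_transversal:
  assumes q: "q \<in> V" and w: "frechet_derivative f (at q) w = 0"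
    and a: "a $ 1 * w $ 2 - a $ 2 * w $ 1 \<noteq> 0" and v: "v $ 1 * w $ 2 - v $ 2 * w $ 1 \<noteq> 0"
  shows "(frechet_derivative f (at q) v \<bullet> frechet_derivative \<nu> (at q) v) / (norm (frechet_derivative f (at q) v))\<^sup>2
    = (frechet_derivative f (at q) a \<bullet> frechet_derivative \<nu> (at q) a) / (norm (frechet_derivative f (at q) a))\<^sup>2"
proof -
  let ?L = "frechet_derivative f (at q)" and ?N = "frechet_derivative \<nu> (at q)"
  have lin: "linear ?L" "linear ?N"
    by (intro linear_frechet_derivative smooth_on_differentiable[OF smooth_f q]
        smooth_on_differentiable[OF smooth_\<nu> q])+
  define r t where "r = (v $ 1 * w $ 2 - v $ 2 * w $ 1) / (a $ 1 * w $ 2 - a $ 2 * w $ 1)"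
    and "t = (a $ 1 * v $ 2 - a $ 2 * v $ 1) / (a $ 1 * w $ 2 - a $ 2 * w $ 1)"
  have "r \<noteq> 0" using a v by (simp add: r_def)
  have v_eq: "v = r *\<^sub>R a + t *\<^sub>R w"
    unfolding r_def t_def by (rule plane_decomposition[OF a])
  have "?L v = r *\<^sub>R ?L a" "?N v = r *\<^sub>R ?N a + t *\<^sub>R ?N w"
    unfolding v_eq using lin w by (simp_all add: linear_add linear_cmul)
  moreover have "?L a \<bullet> ?N w = 0"
    using df_dot_d\<nu>_commute[OF q, of a w] w by simp
  ultimately have "?L v \<bullet> ?N v = r\<^sup>2 * (?L a \<bullet> ?N a)" "(norm (?L v))\<^sup>2 = r\<^sup>2 * (norm (?L a))\<^sup>2"
    by (simp_all add: inner_simps power2_eq_square power_mult_distrib)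
  then show ?thesis
    using \<open>r \<noteq> 0\<close> by simp
qed

lemma coordinate_normal_curvature:
  assumes p: "p \<in> V" and x: "oriented_coordinates_at p D x" "pderiv_at 2 (f \<circ> x) 0 = 0"
    and a: "frechet_derivative f (at p) a \<noteq> 0"
  shows "(pderiv_at 1 (pderiv_at 1 (f \<circ> x)) 0 \<bullet> \<nu> p) / (norm (pderiv_at 1 (f \<circ> x) 0))\<^sup>2
    = - (frechet_derivative f (at p) a \<bullet> frechet_derivative \<nu> (at p) a) / (norm (frechet_derivative f (at p) a))\<^sup>2"
proof -
  have D: "open D" "0 \<in> D" "x 0 = p" "smooth_on x D"
    and det: "det (matrix (frechet_derivative x (at 0))) > 0"
    using x(1) unfolding oriented_coordinates_at_def by simp_all
  \<comment> \<open>The coordinates may leave \<open>V\<close>, where nothing is known about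
    \<open>\<nu>\<close>.\<close>
  define D' where "D' = D \<inter> x -` V"
  have "open D'"
    unfolding D'_def by (rule continuous_open_preimage[OF smooth_on_continuous[OF D(4)] D(1) open_V])
  moreover have "0 \<in> D'" "D' \<subseteq> D" "\<And>d. d \<in> D' \<Longrightarrow> x d \<in> V"
    by (simp_all add: D'_def D(2,3) p)
  ultimately have D': "open D'" "0 \<in> D'" "D' \<subseteq> D" "\<And>d. d \<in> D' \<Longrightarrow> x d \<in> V" .
  have smx: "smooth_on x D'" using D(4) D'(3) by (rule smooth_on_subset)
  have smfx: "smooth_on (f \<circ> x) D'"
    using smooth_on_compose[OF D'(1) open_V D'(4) smx smooth_f] by (simp add: o_def)
  have comp: "pderiv_at i (h \<circ> x) d = frechet_derivative h (at (x d)) (pderiv_at i x d)"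
    if "smooth_on h V" "d \<in> D'" for i d and h :: "real^2 \<Rightarrow> real^3"
    unfolding pderiv_at_def
    using frechet_derivative_compose[OF smooth_on_differentiable[OF smx that(2)]
        smooth_on_differentiable[OF that(1) D'(4)[OF that(2)]]] by simp
  let ?L = "frechet_derivative f (at p)" and ?N = "frechet_derivative \<nu> (at p)"
  let ?X = "\<lambda>i. pderiv_at i x 0"
  have fx: "pderiv_at i (f \<circ> x) 0 = ?L (?X i)" and nx: "pderiv_at i (\<nu> \<circ> x) 0 = ?N (?X i)" for i
    using comp[OF smooth_f D'(2)] comp[OF smooth_\<nu> D'(2)] D(3) by simp_all
  \<comment> \<open>Differentiating <f_u, \<nu>> = 0 along u trades <f_uu, \<nu>> for -<f_u, nu_u>;
    the minus sign in the claim comes from here.\<close>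
  have "pderiv_at 1 (\<lambda>d. pderiv_at 1 (f \<circ> x) d \<bullet> (\<nu> \<circ> x) d) 0 = pderiv_at 1 (\<lambda>_. 0) 0"
    by (rule pderiv_at_cong[OF D'(1,2)]) (simp add: comp[OF smooth_f] df_orthogonal_\<nu> D'(4))
  also have "\<dots> = (0::real)" by (simp add: pderiv_at_def)
  also have "pderiv_at 1 (\<lambda>d. pderiv_at 1 (f \<circ> x) d \<bullet> (\<nu> \<circ> x) d) 0 =
      pderiv_at 1 (f \<circ> x) 0 \<bullet> pderiv_at 1 (\<nu> \<circ> x) 0 + pderiv_at 1 (pderiv_at 1 (f \<circ> x)) 0 \<bullet> (\<nu> \<circ> x) 0"
    by (intro pderiv_at_inner smooth_on_differentiable[OF smooth_on_pderiv[OF smfx] D'(2)]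
        differentiable_chain_at smooth_on_differentiable[OF smx D'(2)]
        smooth_on_differentiable[OF smooth_\<nu> D'(4)[OF D'(2)]])
  finally have 1: "pderiv_at 1 (pderiv_at 1 (f \<circ> x)) 0 \<bullet> \<nu> p = - (?L (?X 1) \<bullet> ?N (?X 1))"
    by (simp add: fx nx D(3))
  have L2: "?L (?X 2) = 0" using x(2) fx by simp
  \<comment> \<open>The Jacobian determinant of \<open>x\<close>: the second coordinate direction
    lies in the kernel of df(p), so the first one is transversal to it.\<close>
  have X: "?X 1 $ 1 * ?X 2 $ 2 - ?X 1 $ 2 * ?X 2 $ 1 \<noteq> 0"
    using det by (simp add: det_2 matrix_def pderiv_at_def mult.commute)
  then have "?X 2 \<noteq> 0" by auto
  from transversal_to_kernel[OF linear_frechet_derivative[OF smooth_on_differentiable[OF smooth_f p]] L2 this a]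
  have "a $ 1 * ?X 2 $ 2 - a $ 2 * ?X 2 $ 1 \<noteq> 0" .
  from normal_curvature_transversal[OF p L2 this X] show ?thesis
    unfolding 1 fx by simp
qed

text \<open>Guarantees that the definite description of the limiting normal curvature ranges over at
  least one coordinate system; an affine one suffices.\<close>

lemma ex_kernel_coordinates:
  assumes p: "p \<in> V" and w: "frechet_derivative f (at p) w = 0" "w \<noteq> 0"
  shows "\<exists>D x. oriented_coordinates_at p D x \<and> pderiv_at 2 (f \<circ> x) 0 = 0"
proof -
  \<comment> \<open>\<open>w\<close> turned clockwise by a right angle: the determinant of (b, w) is
    |w|^2 > 0, and orthogonality lets inner products invert the chart.\<close>
  define b :: "real^2" where "b = vector [w $ 2, - w $ 1]"
  define x where "x d = p + (d $ 1 *\<^sub>R b + d $ 2 *\<^sub>R w)" for d :: "real^2"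
  define y :: "real^2 \<Rightarrow> real^2" where "y z = (((z - p) \<bullet> b) / (w \<bullet> w)) *\<^sub>R axis 1 1
    + (((z - p) \<bullet> w) / (w \<bullet> w)) *\<^sub>R axis 2 1" for z
  have ww: "w \<bullet> w = w $ 1 * w $ 1 + w $ 2 * w $ 2" "w \<bullet> w > 0"
    by (simp add: inner_vec_def sum_2) (use w(2) in simp)
  have inner: "b \<bullet> b = w \<bullet> w" "b \<bullet> w = 0" "w \<bullet> b = 0"
    by (simp_all add: b_def inner_vec_def sum_2)
  have yx: "y (x d) = d" for d
    using ww(2) by (simp add: y_def x_def inner_simps inner vec_eq_iff forall_2 axis_def)
  have xy: "x (y z) = z" for z
  proof -
    define u where "u = z - p"
    have "(w \<bullet> w) *\<^sub>R u = (u \<bullet> b) *\<^sub>R b + (u \<bullet> w) *\<^sub>R w"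
      by (simp add: b_def inner_vec_def sum_2 vec_eq_iff forall_2 algebra_simps)
    then have "u = (1 / (w \<bullet> w)) *\<^sub>R ((u \<bullet> b) *\<^sub>R b + (u \<bullet> w) *\<^sub>R w)"
      using ww(2) by (metis scaleR_scaleR divide_inverse mult_1 left_inverse scaleR_one less_irrefl)
    then have "u = ((u \<bullet> b) / (w \<bullet> w)) *\<^sub>R b + ((u \<bullet> w) / (w \<bullet> w)) *\<^sub>R w"
      by (simp add: scaleR_add_right)
    then show ?thesis
      unfolding x_def y_def u_def by (simp add: axis_def)
  qed
  have der: "(x has_derivative (\<lambda>v. v $ 1 *\<^sub>R b + v $ 2 *\<^sub>R w)) (at d)" for d
    unfolding x_def
    by (auto intro!: derivative_eq_intros bounded_linear.has_derivative[OF bounded_linear_vec_nth])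
  have dx: "frechet_derivative x (at d) = (\<lambda>v. v $ 1 *\<^sub>R b + v $ 2 *\<^sub>R w)"
    and x_diff: "x differentiable at d" for d
    using frechet_derivative_at[OF der, of d] differentiableI[OF der] by simp_all
  have "smooth_on x UNIV"
    unfolding x_def
    by (intro smooth_on_add smooth_on_scaleR smooth_on_const open_UNIV
        smooth_on_bounded_linear[OF bounded_linear_vec_nth] smooth_on_ident)
  moreover have "smooth_on y UNIV"
    unfolding y_def
    by (intro smooth_on_add smooth_on_scaleR smooth_on_const open_UNIV smooth_on_divide
        smooth_on_inner smooth_on_diff smooth_on_ident) (use ww(2) in simp_all)
  moreover have "range x = UNIV"
    using xy by (metis surj_def)
  moreover have "det (matrix (frechet_derivative x (at d))) > 0" for d
    using ww by (simp add: dx det_2 matrix_def axis_def b_def)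
  moreover have "x 0 = p" by (simp add: x_def)
  ultimately have "oriented_coordinates_at p UNIV x"
    unfolding oriented_coordinates_at_def using yx by auto
  moreover have "pderiv_at 2 (f \<circ> x) 0 = 0"
    using frechet_derivative_compose[OF x_diff, of f 0] smooth_on_differentiable[OF smooth_f p] w(1) \<open>x 0 = p\<close>
    by (simp add: pderiv_at_def dx axis_def)
  ultimately show ?thesis by blast
qed

lemma limiting_normal_curvature_eq:
  assumes p: "p \<in> V" and w: "frechet_derivative f (at p) w = 0" "w \<noteq> 0"
    and a: "frechet_derivative f (at p) a \<noteq> 0"
  shows "limiting_normal_curvature f \<nu> p =
    - (frechet_derivative f (at p) a \<bullet> frechet_derivative \<nu> (at p) a) / (norm (frechet_derivative f (at p) a))\<^sup>2"
proof -
  obtain D x where Dx: "oriented_coordinates_at p D x" "pderiv_at 2 (f \<circ> x) 0 = 0"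
    using ex_kernel_coordinates[OF p w] by blast
  show ?thesis
    unfolding limiting_normal_curvature_def
  proof (rule the_equality)
    show "\<exists>D x. oriented_coordinates_at p D x \<and> pderiv_at 2 (f \<circ> x) 0 = 0 \<and>
      - (frechet_derivative f (at p) a \<bullet> frechet_derivative \<nu> (at p) a) / (norm (frechet_derivative f (at p) a))\<^sup>2 =
      (pderiv_at 1 (pderiv_at 1 (f \<circ> x)) 0 \<bullet> \<nu> p) / (norm (pderiv_at 1 (f \<circ> x) 0))\<^sup>2"
      by (intro exI[of _ D] exI[of _ x] conjI Dx coordinate_normal_curvature[OF p Dx a, symmetric])
  next
    fix \<kappa>
    assume "\<exists>D x. oriented_coordinates_at p D x \<and> pderiv_at 2 (f \<circ> x) 0 = 0 \<and>
      \<kappa> = (pderiv_at 1 (pderiv_at 1 (f \<circ> x)) 0 \<bullet> \<nu> p) / (norm (pderiv_at 1 (f \<circ> x) 0))\<^sup>2"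
    then obtain D x where x: "oriented_coordinates_at p D x" "pderiv_at 2 (f \<circ> x) 0 = 0"
      and \<kappa>: "\<kappa> = (pderiv_at 1 (pderiv_at 1 (f \<circ> x)) 0 \<bullet> \<nu> p) / (norm (pderiv_at 1 (f \<circ> x) 0))\<^sup>2"
      by (elim exE conjE)
    show "\<kappa> = - (frechet_derivative f (at p) a \<bullet> frechet_derivative \<nu> (at p) a) / (norm (frechet_derivative f (at p) a))\<^sup>2"
      using \<kappa> coordinate_normal_curvature[OF p x a] by (rule trans)
  qed
qed

lemma limiting_normal_curvature_zero_iff:
  assumes p: "p \<in> V" and w: "frechet_derivative f (at p) w = 0" "frechet_derivative \<nu> (at p) w \<noteq> 0"
    and a: "frechet_derivative f (at p) a \<noteq> 0"
  shows "limiting_normal_curvature f \<nu> p = 0 \<longleftrightarrow> \<not> immersion_at \<nu> p"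
proof -
  let ?L = "frechet_derivative f (at p)" and ?N = "frechet_derivative \<nu> (at p)"
  have lin: "linear ?L" "linear ?N"
    by (intro linear_frechet_derivative smooth_on_differentiable[OF smooth_f p]
        smooth_on_differentiable[OF smooth_\<nu> p])+
  have "w \<noteq> 0" using w(2) linear_0[OF lin(2)] by auto
  have LNw: "?L a \<bullet> ?N w = 0"
    using df_dot_d\<nu>_commute[OF p, of a w] w by simp
  have N\<nu>: "?N v \<bullet> \<nu> p = 0" for v
    by (simp add: frechet_derivative_plane smooth_on_differentiable[OF smooth_\<nu> p] inner_simps
        \<nu>\<^sub>1_orthogonal_\<nu>[OF p])
  have "?L a \<bullet> ?N a = 0 \<longleftrightarrow> \<not> inj ?N"
  proof
    assume 0: "?L a \<bullet> ?N a = 0"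
    \<comment> \<open>Both \<open>?N w\<close> and \<open>?N a\<close> are orthogonal to
      \<open>?L a\<close>. Their cross product is also a multiple of \<open>\<nu> p\<close>, whose
      cross product with \<open>?L a\<close> is non-zero, so the multiple is zero.\<close>
    have "cross3 (?L a) (cross3 (?N w) (?N a)) = 0"
      using 0 LNw by (simp add: Lagrange)
    then have "det (vector [?N w, ?N a, \<nu> p]) *\<^sub>R cross3 (?L a) (\<nu> p) = 0"
      by (simp add: cross3_eq_scaleR_normal[OF N\<nu> N\<nu> norm_\<nu>[OF p]] cross_mult_right)
    moreover have "cross3 (?L a) (\<nu> p) \<noteq> 0"
      using norm_and_cross_eq_0[of "?L a" "\<nu> p"] df_orthogonal_\<nu>[OF p] a \<nu>_nonzero[OF p] by blast
    ultimately have "cross3 (?N w) (?N a) = 0"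
      by (simp add: cross3_eq_scaleR_normal[OF N\<nu> N\<nu> norm_\<nu>[OF p]])
    then obtain c where "?N a = c *\<^sub>R ?N w"
      unfolding cross_eq_0 collinear_lemma using w(2) by (metis scaleR_zero_left)
    \<comment> \<open>\<open>a\<close> and c w have the same image under \<open>?N\<close>, yet are
      distinct because \<open>?L\<close> separates them.\<close>
    then have "?N a = ?N (c *\<^sub>R w)" "?L a \<noteq> ?L (c *\<^sub>R w)"
      using lin w a by (simp_all add: linear_cmul)
    then show "\<not> inj ?N" by (metis injD)
  next
    assume "\<not> inj ?N"
    then obtain v where v: "?N v = 0" "v \<noteq> 0"
      unfolding linear_injective_0[OF lin(2)] by blast
    obtain r t where rt: "v = r *\<^sub>R a + t *\<^sub>R w"
      using plane_decomposition[OF transversal_to_kernel[OF lin(1) w(1) \<open>w \<noteq> 0\<close> a]] by blast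
    have N: "r *\<^sub>R ?N a + t *\<^sub>R ?N w = 0"
      using v(1) lin(2) by (simp add: rt linear_add linear_cmul)
    then have "?L a \<bullet> (r *\<^sub>R ?N a + t *\<^sub>R ?N w) = 0" by simp
    then have "r * (?L a \<bullet> ?N a) = 0"
      using LNw by (simp add: inner_simps)
    \<comment> \<open>Otherwise v = t w with t non-zero, contradicting \<open>?N w\<close> being
      non-zero.\<close>
    moreover have "r \<noteq> 0"
      using N w(2) v(2) rt by auto
    ultimately show "?L a \<bullet> ?N a = 0" by simp
  qed
  then show ?thesis
    using limiting_normal_curvature_eq[OF p w(1) \<open>w \<noteq> 0\<close> a] a by (simp add: immersion_at_def)
qed

text \<open>Some directional derivative of \<open>\<Lambda>\<close> stays non-zero near
  \<open>p\<close>, so \<open>\<Lambda>\<close> cannot vanish on a non-empty open set there. The set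
  \<open>N\<close> leaves room to shrink the ball into the domain of a second normal field.\<close>

lemma regular_dense:
  assumes p: "p \<in> V" and nd: "frechet_derivative \<Lambda> (at p) \<noteq> (\<lambda>_. 0)" and N: "open N" "p \<in> N"
  obtains e where "e > 0" "ball p e \<subseteq> V \<inter> N" "ball p e \<subseteq> closure (regular \<inter> ball p e)"
proof -
  obtain b where b: "frechet_derivative \<Lambda> (at p) b \<noteq> 0"
    using nd unfolding fun_eq_iff by blast
  define T where "T = (V \<inter> (\<lambda>q. frechet_derivative \<Lambda> (at q) b) -` (- {0})) \<inter> N"
  have "open T"
    unfolding T_def
    by (intro open_Int continuous_open_preimage open_V N(1) open_Compl closed_singleton
        smooth_on_continuous smooth_on_derivative smooth_\<Lambda>)
  moreover have "p \<in> T" using p b N by (simp add: T_def)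
  ultimately obtain e where e: "e > 0" "ball p e \<subseteq> T" by (rule openE)
  show thesis
  proof (rule that[OF e(1)])
    show "ball p e \<subseteq> V \<inter> N" using e(2) by (auto simp: T_def)
    show "ball p e \<subseteq> closure (regular \<inter> ball p e)"
    proof (rule subsetI, rule ccontr)
      fix q assume q: "q \<in> ball p e" "q \<notin> closure (regular \<inter> ball p e)"
      let ?S = "ball p e - closure (regular \<inter> ball p e)"
      have "frechet_derivative \<Lambda> (at q) = frechet_derivative (\<lambda>_. 0) (at q)"
      proof (rule frechet_derivative_cong_open)
        show "open ?S" by (simp add: open_Diff)
        show "q \<in> ?S" using q by simp
        show "\<Lambda> y = 0" if "y \<in> ?S" for y
        proof -
          have y: "y \<in> ball p e" "y \<notin> closure (regular \<inter> ball p e)"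
            using that by simp_all
          have "y \<notin> regular \<inter> ball p e"
            by (rule contra_subsetD[OF closure_subset y(2)])
          then show ?thesis using y(1) e(2) by (auto simp: T_def)
        qed
      qed
      then show False using q(1) e(2) by (auto simp: T_def)
    qed
  qed
qed

text \<open>\<open>front\<close> supplies its own normal \<open>n\<close>, which is shown to be
  \<open>s q *\<^sub>R \<nu> q\<close> with \<open>s q * s q = 1\<close>. Since s has zero
  derivative in direction \<open>w\<close>, a kernel vector of both df and dnu would also be killed
  by dn, against the immersion property of (f, n).\<close>

lemma front_kernel:
  assumes "front U f" "p \<in> U" and p: "p \<in> V" and nd: "frechet_derivative \<Lambda> (at p) \<noteq> (\<lambda>_. 0)"
    and w: "frechet_derivative f (at p) w = 0" "w \<noteq> 0"
  shows "frechet_derivative \<nu> (at p) w \<noteq> 0"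
proof
  assume Nw: "frechet_derivative \<nu> (at p) w = 0"
  obtain V' n where V': "open V'" "p \<in> V'" "unit_normal_field V' f n"
    and imm: "immersion_at (\<lambda>y. (f y, n y)) p"
    using assms(1,2) unfolding front_def by blast
  have n: "smooth_on n V'" "\<And>q. q \<in> V' \<Longrightarrow> n q \<bullet> n q = 1"
    "\<And>q i. q \<in> V' \<Longrightarrow> n q \<bullet> f\<^sub>1 i q = 0"
    using V'(3) by (auto simp: unit_normal_field_def pderiv_at_def inner_commute dot_square_norm)
  obtain e where e: "e > 0" "ball p e \<subseteq> V \<inter> V'" "ball p e \<subseteq> closure (regular \<inter> ball p e)"
    using regular_dense[OF p nd V'(1,2)] .
  define s where "s q = n q \<bullet> \<nu> q" for q
  have sm: "smooth_on n (ball p e)" "smooth_on \<nu> (ball p e)" "smooth_on s (ball p e)"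
  proof -
    show 1: "smooth_on n (ball p e)" "smooth_on \<nu> (ball p e)"
      using smooth_on_subset[OF n(1)] smooth_on_subset[OF smooth_\<nu>] e(2) by simp_all
    show "smooth_on s (ball p e)"
      unfolding s_def by (rule smooth_on_inner[OF open_ball 1])
  qed
  \<comment> \<open>At regular points both unit normals span the same line, so the identity holds
    there; density and continuity carry it to the singular points.\<close>
  have s2: "s q * s q = 1" if q: "q \<in> ball p e" for q
  proof (rule ccontr)
    assume ne: "s q * s q \<noteq> 1"
    let ?S = "ball p e \<inter> (\<lambda>q. s q * s q) -` (- {1})"
    have "open ?S"
      by (intro continuous_open_preimage continuous_on_mult open_ball open_Compl closed_singleton
          smooth_on_continuous sm(3))
    moreover have "q \<in> ?S \<inter> closure (regular \<inter> ball p e)"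
      using q ne e(3) by auto
    ultimately have "?S \<inter> (regular \<inter> ball p e) \<noteq> {}"
      using open_Int_closure_eq_empty[of ?S "regular \<inter> ball p e"] by blast
    then obtain z where z: "z \<in> ?S" "z \<in> regular" by blast
    then have zV: "z \<in> V" "z \<in> V'" using e(2) by auto
    have "n z = s z *\<^sub>R \<nu> z"
      unfolding s_def using orthogonal_tangent_imp_normal[OF z(2)] n(3)[OF zV(2)] by blast
    then have "n z \<bullet> n z = s z * s z * (\<nu> z \<bullet> \<nu> z)" by simp
    then show False using z(1) n(2)[OF zV(2)] \<nu>_unit[OF zV(1)] by simp
  qed
  \<comment> \<open>At singular points the tangent image does not fix the normal line, so equality
    is deduced from |n - s \<nu>|^2 = 1 - s^2.\<close>
  have n_eq: "n q = s q *\<^sub>R \<nu> q" if q: "q \<in> ball p e" for q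
  proof -
    have "q \<in> V" "q \<in> V'" using e(2) q by auto
    then have "(n q - s q *\<^sub>R \<nu> q) \<bullet> (n q - s q *\<^sub>R \<nu> q) = 1 - s q * s q"
      using n(2) \<nu>_unit by (simp add: inner_diff_left inner_diff_right s_def inner_commute)
    then show ?thesis using s2[OF q] by simp
  qed
  have pe: "p \<in> ball p e" using e(1) by simp
  note diff = smooth_on_differentiable[OF _ pe]
  have ds2: "((\<lambda>q. s q * s q) has_derivative (\<lambda>v. s p * frechet_derivative s (at p) v + frechet_derivative s (at p) v * s p)) (at p)"
    by (intro has_derivative_mult frechet_derivative_works' diff sm)
  have "frechet_derivative (\<lambda>q. s q * s q) (at p) w = s p * frechet_derivative s (at p) w + frechet_derivative s (at p) w * s p"
    unfolding frechet_derivative_at[OF ds2, symmetric] ..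
  moreover have "frechet_derivative (\<lambda>q. s q * s q) (at p) = frechet_derivative (\<lambda>_. 1) (at p)"
    by (rule frechet_derivative_cong_open[OF open_ball pe s2])
  ultimately have sw: "frechet_derivative s (at p) w = 0"
    using s2[OF pe] by auto
  have ds\<nu>: "((\<lambda>q. s q *\<^sub>R \<nu> q) has_derivative (\<lambda>v. s p *\<^sub>R frechet_derivative \<nu> (at p) v + frechet_derivative s (at p) v *\<^sub>R \<nu> p)) (at p)"
    by (intro has_derivative_scaleR frechet_derivative_works' diff sm)
  have "frechet_derivative (\<lambda>q. s q *\<^sub>R \<nu> q) (at p) w = 0"
    unfolding frechet_derivative_at[OF ds\<nu>, symmetric] by (simp add: sw Nw)
  then have nw: "frechet_derivative n (at p) w = 0"
    using frechet_derivative_cong_open[OF open_ball pe n_eq] by simp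
  have fd: "f differentiable at p" by (rule smooth_on_differentiable[OF smooth_f p])
  have der: "((\<lambda>y. (f y, n y)) has_derivative (\<lambda>v. (frechet_derivative f (at p) v, frechet_derivative n (at p) v))) (at p)"
    by (intro has_derivative_Pair frechet_derivative_works' fd diff sm)
  have "inj (\<lambda>v. (frechet_derivative f (at p) v, frechet_derivative n (at p) v))"
    using imm unfolding immersion_at_def frechet_derivative_at[OF der, symmetric] .
  moreover have "frechet_derivative f (at p) 0 = 0" "frechet_derivative n (at p) 0 = 0"
    by (intro linear_0 linear_frechet_derivative fd diff sm)+
  ultimately show False
    using w nw injD[of "\<lambda>v. (frechet_derivative f (at p) v, frechet_derivative n (at p) v)" w 0] by simp
qed

end

subsection \<open>Blow up\<close>

lemma blowup_proj_eq_iff: "blowup_proj a = blowup_proj b \<longleftrightarrow> blowup_rel a b"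
  by transfer simp

lemma blowup_proj_surj: obtains a where "m = blowup_proj a"
proof -
  have "\<exists>a. m = blowup_proj a"
    by transfer (use equivp_reflp[OF equivp_blowup_rel] in blast)
  then show thesis using that by blast
qed

lemma blowup_map_at_proj: "blowup_map_at p (blowup_proj a) = p + polar a"
  unfolding blowup_map_at_def by transfer simp

lemma blowup_rel_iff:
  "blowup_rel a b \<longleftrightarrow> (\<exists>k::int. b = (if even k then fst a else - fst a, snd a + of_int k * pi))"
  by (auto simp: blowup_rel_def prod_eq_iff)

text \<open>Descends a function built from local data of a proof, by choosing a representative of
  each class.\<close>

lemma blowup_lift:
  assumes "\<And>a b. blowup_rel a b \<Longrightarrow> h a = h b"
  obtains \<rho> where "\<rho> \<circ> blowup_proj = h"
proof
  show "(\<lambda>m. h (SOME a. blowup_proj a = m)) \<circ> blowup_proj = h"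
  proof
    fix a
    have "blowup_proj (SOME b. blowup_proj b = blowup_proj a) = blowup_proj a"
      by (rule someI) (rule refl)
    then show "((\<lambda>m. h (SOME a. blowup_proj a = m)) \<circ> blowup_proj) a = h a"
      using assms by (simp add: blowup_proj_eq_iff)
  qed
qed

lemma polar_component: "polar a $ 1 = fst a * cos (snd a)" "polar a $ 2 = fst a * sin (snd a)"
  by (simp_all add: polar_def)

lemma norm_polar: "norm (polar a) = \<bar>fst a\<bar>"
proof -
  have "(norm (polar a))\<^sup>2 = (fst a * cos (snd a))\<^sup>2 + (fst a * sin (snd a))\<^sup>2"
    unfolding power2_norm_eq_inner
    by (simp add: inner_vec_def sum_2 polar_component power2_eq_square)
  also have "\<dots> = (fst a)\<^sup>2 * ((sin (snd a))\<^sup>2 + (cos (snd a))\<^sup>2)"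
    by algebra
  finally have "(norm (polar a))\<^sup>2 = \<bar>fst a\<bar>\<^sup>2" by simp
  then show ?thesis by (simp only: power2_eq_iff_nonneg norm_ge_zero abs_ge_zero)
qed

lemma cos_sin_int_pi:
  fixes k :: int
  shows "cos (t + of_int k * pi) = (if even k then cos t else - cos t)"
    "sin (t + of_int k * pi) = (if even k then sin t else - sin t)"
proof -
  have "sin (of_int k * pi) = 0" by (simp add: sin_zero_iff_int2)
  moreover have "cos (of_int k * pi) = (if even k then 1 else -1)"
    using cos_npi_int[of k] by (simp add: mult.commute)
  ultimately show "cos (t + of_int k * pi) = (if even k then cos t else - cos t)"
    "sin (t + of_int k * pi) = (if even k then sin t else - sin t)"
    by (simp_all add: cos_add sin_add)
qed

lemma polar_rel: "blowup_rel a b \<Longrightarrow> polar a = polar b"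
  unfolding blowup_rel_iff
  by (auto simp: vec_eq_iff forall_2 polar_component cos_sin_int_pi)

lemma smooth_on_fst: "open S \<Longrightarrow> smooth_on fst S" and smooth_on_snd: "open S \<Longrightarrow> smooth_on snd S"
  using smooth_on_bounded_linear[OF bounded_linear_fst _ smooth_on_ident]
    smooth_on_bounded_linear[OF bounded_linear_snd _ smooth_on_ident] by blast+

lemma smooth_on_cos_snd: "open S \<Longrightarrow> smooth_on (\<lambda>a::real \<times> real. cos (snd a)) S"
  and smooth_on_sin_snd: "open S \<Longrightarrow> smooth_on (\<lambda>a::real \<times> real. sin (snd a)) S"
proof -
  assume S: "open S"
  have "smooth_on (cos :: real \<Rightarrow> real) UNIV" "smooth_on (sin :: real \<Rightarrow> real) UNIV"
    unfolding smooth_on_def using Ck_on_sin_cos by blast+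
  then show "smooth_on (\<lambda>a::real \<times> real. cos (snd a)) S" "smooth_on (\<lambda>a::real \<times> real. sin (snd a)) S"
    using smooth_on_compose[OF S open_UNIV UNIV_I smooth_on_snd[OF S], of cos]
      smooth_on_compose[OF S open_UNIV UNIV_I smooth_on_snd[OF S], of sin] by simp_all
qed

lemma smooth_on_polar: "open S \<Longrightarrow> smooth_on polar S"
proof -
  assume S: "open S"
  have "smooth_on (\<lambda>a. (fst a * cos (snd a)) *\<^sub>R axis 1 1 + (fst a * sin (snd a)) *\<^sub>R axis 2 1 :: real^2) S"
    by (intro smooth_on_add smooth_on_scaleR smooth_on_mult smooth_on_const S
        smooth_on_fst smooth_on_cos_snd smooth_on_sin_snd)
  then show ?thesis
    by (rule smooth_on_cong[OF S]) (simp add: vec_eq_iff forall_2 polar_component axis_def)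
qed

lemma open_strip: "open {a :: real \<times> real. \<bar>fst a\<bar> < e}"
  by (intro open_Collect_less continuous_intros)

text \<open>The quotient is only odd under the identification, so it does not descend to the blow up;
  products of two such quotients do.\<close>

lemma polar_quotient:
  fixes h :: "real^2 \<Rightarrow> real"
  assumes "smooth_on h (ball p e)" "e > 0" "h p = 0"
  obtains l where "smooth_on l {a. \<bar>fst a\<bar> < e}"
    "\<And>a. \<bar>fst a\<bar> < e \<Longrightarrow> h (p + polar a) = fst a * l a"
    "\<And>t. l (0, t) = cos t * pderiv_at 1 h p + sin t * pderiv_at 2 h p"
    "\<And>a (k::int). l (if even k then fst a else - fst a, snd a + of_int k * pi) = (if even k then l a else - l a)"
proof -
  obtain g1 g2 where g: "smooth_on g1 (ball 0 e)" "smooth_on g2 (ball 0 e)"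
    "g1 0 = pderiv_at 1 h p" "g2 0 = pderiv_at 2 h p"
    "\<And>x. x \<in> ball 0 e \<Longrightarrow> h (p + x) = x $ 1 * g1 x + x $ 2 * g2 x"
    using Hadamard_plane[OF assms] by blast
  \<comment> \<open>Both coordinates of \<open>polar a\<close> contain the factor
    \<open>fst a\<close>; taking it out of the Hadamard decomposition leaves this function, smooth
    across the exceptional circle.\<close>
  define l where "l a = cos (snd a) * g1 (polar a) + sin (snd a) * g2 (polar a)" for a
  have mem: "polar a \<in> ball 0 e" if "a \<in> {a. \<bar>fst a\<bar> < e}" for a
    using that by (simp add: norm_polar)
  have "smooth_on (\<lambda>a. g1 (polar a)) {a. \<bar>fst a\<bar> < e}" "smooth_on (\<lambda>a. g2 (polar a)) {a. \<bar>fst a\<bar> < e}"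
    using smooth_on_compose[OF open_strip open_ball mem smooth_on_polar[OF open_strip] g(1)]
      smooth_on_compose[OF open_strip open_ball mem smooth_on_polar[OF open_strip] g(2)] by blast+
  then have "smooth_on l {a. \<bar>fst a\<bar> < e}"
    unfolding l_def
    by (intro smooth_on_add smooth_on_mult smooth_on_cos_snd smooth_on_sin_snd open_strip)
  moreover have "h (p + polar a) = fst a * l a" if "\<bar>fst a\<bar> < e" for a
    using g(5)[OF mem] that by (simp add: l_def polar_component algebra_simps)
  moreover have "l (0, t) = cos t * pderiv_at 1 h p + sin t * pderiv_at 2 h p" for t
  proof -
    have "polar (0, t) = 0" using norm_polar[of "(0, t)"] by simp
    then show ?thesis by (simp add: l_def g)
  qed
  \<comment> \<open>Valid outside the strip as well, since only equality of the \<open>polar\<close>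
    values is used; products of such functions therefore descend to the whole blow up.\<close>
  moreover have "l (if even k then fst a else - fst a, snd a + of_int k * pi) = (if even k then l a else - l a)"
    for a and k :: int
  proof -
    have "polar (if even k then fst a else - fst a, snd a + of_int k * pi) = polar a"
      using polar_rel[of a] unfolding blowup_rel_iff by metis
    then show ?thesis by (simp add: l_def cos_sin_int_pi)
  qed
  ultimately show thesis by (rule that)
qed

lemma polar_quotient_product_rel:
  assumes l: "\<And>a (k::int). l (if even k then fst a else - fst a, snd a + of_int k * pi) = (if even k then l a else - l a :: real)"
    and m: "\<And>a (k::int). m (if even k then fst a else - fst a, snd a + of_int k * pi) = (if even k then m a else - m a :: real)"
    and ab: "blowup_rel a b"
  shows "l a * m a = l b * m b"
proof -
  obtain k :: int where b: "b = (if even k then fst a else - fst a, snd a + of_int k * pi)"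
    using ab unfolding blowup_rel_iff by blast
  show ?thesis unfolding b l m by simp
qed

text \<open>A non-zero linear form vanishes on a single line through 0, and a line is one point of
  the exceptional circle because angles count modulo pi. Eliminating between two zeros leaves sin(t'
  - t) times each coefficient.\<close>

lemma finite_directions:
  assumes "c1 \<noteq> 0 \<or> c2 \<noteq> 0"
  shows "finite {blowup_proj (0, t) | t. cos t * c1 + sin t * c2 = 0}"
proof -
  have eq: "blowup_proj (0, t) = blowup_proj (0, t')"
    if t: "cos t * c1 + sin t * c2 = 0" and t': "cos t' * c1 + sin t' * c2 = 0" for t t'
  proof -
    have "sin (t' - t) * c1 = sin t' * (cos t * c1 + sin t * c2) - sin t * (cos t' * c1 + sin t' * c2)"
      "sin (t' - t) * c2 = cos t * (cos t' * c1 + sin t' * c2) - cos t' * (cos t * c1 + sin t * c2)"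
      by (simp_all add: sin_diff algebra_simps)
    then have "sin (t' - t) = 0" using assms t t' by auto
    then obtain k :: int where "t' - t = of_int k * pi"
      unfolding sin_zero_iff_int2 by blast
    then show ?thesis
      unfolding blowup_proj_eq_iff blowup_rel_def by (intro exI[of _ k]) simp
  qed
  show ?thesis
  proof (cases "\<exists>t. cos t * c1 + sin t * c2 = 0")
    case True
    then obtain t where "cos t * c1 + sin t * c2 = 0" by blast
    then have "{blowup_proj (0, t) | t. cos t * c1 + sin t * c2 = 0} \<subseteq> {blowup_proj (0, t)}"
      using eq by blast
    then show ?thesis by (rule finite_subset) simp
  qed simp
qed

text \<open>Angles in an open interval of length pi give pairwise distinct points of the exceptional
  circle, so infinitely many are available.\<close>

lemma direction_avoiding_finite:
  assumes "finite Z"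
  obtains t where "blowup_proj (0, t) \<notin> Z"
proof -
  have "inj_on (\<lambda>t. blowup_proj (0, t)) {0<..<pi}"
  proof (rule inj_onI)
    fix t t' assume t: "t \<in> {0<..<pi}" "t' \<in> {0<..<pi}" "blowup_proj (0, t) = blowup_proj (0, t')"
    then obtain k :: int where k: "t' = t + of_int k * pi"
      unfolding blowup_proj_eq_iff blowup_rel_def by auto
    then have "\<bar>of_int k * pi\<bar> < 1 * pi" using t by auto
    then have "\<bar>real_of_int k\<bar> < 1" by (simp add: abs_mult)
    then show "t = t'" using k by simp
  qed
  moreover have "infinite {0<..<pi}" by simp
  ultimately have "infinite ((\<lambda>t. blowup_proj (0, t)) ` {0<..<pi})"
    using finite_imageD by blast
  then have "\<not> (\<lambda>t. blowup_proj (0, t)) ` {0<..<pi} \<subseteq> Z"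
    using assms finite_subset by blast
  then show thesis using that by blast
qed

section \<open>Rational boundedness in terms of the Jacobian of the Gauss map\<close>

context surface_with_normal
begin

text \<open>\<Lambda> is bilinear in the two partial derivatives of \<open>f\<close>. If both
  vanished at \<open>p\<close>, every product rule term would keep a vanishing factor and d
  lambda(p) would be zero.\<close>

lemma ex_nonzero_derivative:
  assumes p: "p \<in> V" and nd: "frechet_derivative \<Lambda> (at p) \<noteq> (\<lambda>_. 0)"
  shows "\<exists>a. frechet_derivative f (at p) a \<noteq> 0"
proof (rule ccontr)
  assume "\<nexists>a. frechet_derivative f (at p) a \<noteq> 0"
  then have 0: "f\<^sub>1 i p = 0" for i by (simp add: pderiv_at_def)
  let ?G = "\<lambda>q. cross3 (f\<^sub>1 2 q) (\<nu> q)"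
  have "smooth_on ?G V"
    by (intro smooth_on_bilinear[OF bounded_bilinear_cross3] open_V smooth_f\<^sub>1 smooth_\<nu>)
  then have "((\<lambda>q. f\<^sub>1 1 q \<bullet> ?G q) has_derivative (\<lambda>v. f\<^sub>1 1 p \<bullet> frechet_derivative ?G (at p) v
      + frechet_derivative (f\<^sub>1 1) (at p) v \<bullet> ?G p)) (at p)"
    by (intro has_derivative_inner frechet_derivative_works' smooth_on_differentiable[OF _ p] smooth_f\<^sub>1)
  moreover have "(\<lambda>q. f\<^sub>1 1 q \<bullet> ?G q) = \<Lambda>"
    by (simp add: fun_eq_iff signed_area_density_def dot_cross_det)
  ultimately have "(\<Lambda> has_derivative (\<lambda>_. 0)) (at p)" by (simp add: 0)
  then show False using nd frechet_derivative_at by metis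
qed

lemma pderiv_signed_area_density_nonzero:
  assumes p: "p \<in> V" and nd: "frechet_derivative \<Lambda> (at p) \<noteq> (\<lambda>_. 0)"
  shows "pderiv_at 1 \<Lambda> p \<noteq> 0 \<or> pderiv_at 2 \<Lambda> p \<noteq> 0"
proof (rule ccontr)
  assume "\<not> (pderiv_at 1 \<Lambda> p \<noteq> 0 \<or> pderiv_at 2 \<Lambda> p \<noteq> 0)"
  then have "frechet_derivative \<Lambda> (at p) = (\<lambda>_. 0)"
    by (intro ext) (simp add: frechet_derivative_plane[OF smooth_on_differentiable[OF smooth_\<Lambda> p]])
  with nd show False by (rule notE)
qed

lemma rationally_bounded_if_Gauss_map_singular:
  assumes p: "p \<in> V" and nd: "frechet_derivative \<Lambda> (at p) \<noteq> (\<lambda>_. 0)"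
    and "V \<subseteq> U" and \<Lambda>p: "\<Lambda> p = 0" and \<mu>p: "\<mu> p = 0"
  shows "gaussian_curvature_rationally_bounded U f p"
proof -
  obtain e where e: "e > 0" "ball p e \<subseteq> V \<inter> UNIV" "ball p e \<subseteq> closure (regular \<inter> ball p e)"
    using regular_dense[OF p nd open_UNIV UNIV_I] .
  have eV: "ball p e \<subseteq> V" using e(2) by simp
  define W where "W = ball p e"
  define O' where "O' = {q \<in> W. immersion_at f q}"
  let ?K = "gaussian_curvature g"
  have O'_eq: "O' = regular \<inter> W"
    using eV immersion_f_iff by (auto simp: O'_def W_def)
  let ?A = "{a :: real \<times> real. \<bar>fst a\<bar> < e}"
  obtain l where l: "smooth_on l ?A" "\<And>a. \<bar>fst a\<bar> < e \<Longrightarrow> \<Lambda> (p + polar a) = fst a * l a"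
    "\<And>t. l (0, t) = cos t * pderiv_at 1 \<Lambda> p + sin t * pderiv_at 2 \<Lambda> p"
    "\<And>a (k::int). l (if even k then fst a else - fst a, snd a + of_int k * pi) = (if even k then l a else - l a)"
    by (rule polar_quotient[OF smooth_on_subset[OF smooth_\<Lambda> eV] e(1) \<Lambda>p]) (rule that)
  obtain m where m: "smooth_on m ?A" "\<And>a. \<bar>fst a\<bar> < e \<Longrightarrow> \<mu> (p + polar a) = fst a * m a"
    "\<And>t. m (0, t) = cos t * pderiv_at 1 \<mu> p + sin t * pderiv_at 2 \<mu> p"
    "\<And>a (k::int). m (if even k then fst a else - fst a, snd a + of_int k * pi) = (if even k then m a else - m a)"
    by (rule polar_quotient[OF smooth_on_subset[OF smooth_\<mu> eV] e(1) \<mu>p]) (rule that)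
  obtain \<rho> where \<rho>: "\<rho> \<circ> blowup_proj = (\<lambda>a. l a * l a)"
    using blowup_lift[OF polar_quotient_product_rel[OF l(4) l(4)]] .
  obtain \<psi> where \<psi>: "\<psi> \<circ> blowup_proj = (\<lambda>a. l a * m a)"
    using blowup_lift[OF polar_quotient_product_rel[OF l(4) m(4)]] .
  have \<rho>a: "\<rho> (blowup_proj a) = l a * l a" and \<psi>a: "\<psi> (blowup_proj a) = l a * m a" for a
    using fun_cong[OF \<rho>, of a] fun_cong[OF \<psi>, of a] by simp_all
  let ?\<Phi> = "blowup_map_at p"
  have inW: "p + polar a \<in> W \<longleftrightarrow> \<bar>fst a\<bar> < e" for a
    by (simp add: W_def dist_norm norm_polar)
  have preimage: "blowup_proj -` (?\<Phi> -` W) = ?A"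
    by (auto simp: blowup_map_at_proj inW)
  have center: "p + polar a = p \<longleftrightarrow> fst a = 0" for a
    using norm_polar[of a] by auto
  \<comment> \<open>\<open>\<Lambda>\<close> is r l here, so regularity means that neither factor
    vanishes; this is condition (a) for \<open>\<rho>\<close> = l^2.\<close>
  have inO: "p + polar a \<in> O' \<longleftrightarrow> \<bar>fst a\<bar> < e \<and> fst a \<noteq> 0 \<and> l a \<noteq> 0" for a
    using eV l(2)[of a] inW[of a] unfolding O'_eq by (auto simp: W_def)
  have \<psi>_smooth: "blowup_smooth_on \<psi> (?\<Phi> -` W)"
    unfolding blowup_smooth_on_def preimage \<psi> by (intro smooth_on_mult open_strip l(1) m(1))
  have "open W" "p \<in> W" "O' \<subseteq> W" using e(1) by (auto simp: W_def O'_def)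
  moreover have "open O'" unfolding O'_eq W_def by (intro open_Int open_regular open_ball)
  moreover have "W \<subseteq> closure O'" using e(3) by (simp add: W_def O'_eq)
  moreover have "smooth_on ?K O'"
    using smooth_gaussian_curvature by (rule smooth_on_subset) (simp add: O'_eq)
  moreover have "blowup_smooth_on \<rho> (?\<Phi> -` W)"
    unfolding blowup_smooth_on_def preimage \<rho> by (intro smooth_on_mult open_strip l(1))
  moreover have "?\<Phi> -` (O' - {p}) = ?\<Phi> -` (W - {p}) \<inter> \<rho> -` (UNIV - {0})"
  proof -
    have "x \<in> ?\<Phi> -` (O' - {p}) \<longleftrightarrow> x \<in> ?\<Phi> -` (W - {p}) \<inter> \<rho> -` (UNIV - {0})" for x
    proof -
      obtain a where "x = blowup_proj a" by (rule blowup_proj_surj)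
      then show ?thesis
        using inO[of a] inW[of a] center[of a] by (auto simp: blowup_map_at_proj \<rho>a)
    qed
    then show ?thesis by blast
  qed
  moreover have "finite (\<rho> -` {0} \<inter> ?\<Phi> -` {p})"
  proof -
    have "\<rho> -` {0} \<inter> ?\<Phi> -` {p} \<subseteq>
        {blowup_proj (0, t) | t. cos t * pderiv_at 1 \<Lambda> p + sin t * pderiv_at 2 \<Lambda> p = 0}"
    proof
      fix x assume x: "x \<in> \<rho> -` {0} \<inter> ?\<Phi> -` {p}"
      obtain a where a: "x = blowup_proj a" by (rule blowup_proj_surj)
      then have "fst a = 0" "l a = 0"
        using x center[of a] by (simp_all add: blowup_map_at_proj \<rho>a)
      then obtain t where t: "a = (0, t)" by (metis prod.collapse)
      then show "x \<in> {blowup_proj (0, t) | t. cos t * pderiv_at 1 \<Lambda> p + sin t * pderiv_at 2 \<Lambda> p = 0}"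
        using a \<open>l a = 0\<close> l(3)[of t] by auto
    qed
    moreover have "pderiv_at 1 \<Lambda> p \<noteq> 0 \<or> pderiv_at 2 \<Lambda> p \<noteq> 0"
      by (rule pderiv_signed_area_density_nonzero[OF p nd])
    ultimately show ?thesis
      using finite_subset[OF _ finite_directions] by simp
  qed
  moreover
  \<comment> \<open>Since \<open>p\<close> is singular, such points lie off the exceptional circle,
    and r cancels from \<mu> / lambda.\<close>
  have "\<psi> x = \<rho> x * ?K (?\<Phi> x)" if x: "x \<in> ?\<Phi> -` O'" for x
  proof -
    obtain a where a: "x = blowup_proj a" by (rule blowup_proj_surj)
    have aO: "p + polar a \<in> O'" using x by (simp add: a blowup_map_at_proj)
    then have nz: "\<bar>fst a\<bar> < e" "fst a \<noteq> 0" "l a \<noteq> 0" using inO by blast+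
    have "?K (p + polar a) = \<mu> (p + polar a) / \<Lambda> (p + polar a)"
      using aO by (intro gaussian_curvature_eq) (simp add: O'_eq)
    also have "\<dots> = m a / l a" using nz by (simp add: l(2) m(2))
    finally show ?thesis
      using nz by (simp add: a blowup_map_at_proj \<rho>a \<psi>a)
  qed
  then have "\<exists>\<psi>. blowup_smooth_on \<psi> (?\<Phi> -` W) \<and> (\<forall>x \<in> ?\<Phi> -` O'. \<psi> x = \<rho> x * ?K (?\<Phi> x))"
    using \<psi>_smooth by blast
  ultimately have "rationally_bounded_at p W O' ?K"
    unfolding rationally_bounded_at_def Let_def
    by - (assumption | rule conjI exI[of _ \<rho>])+
  moreover have "W \<subseteq> U" using eV \<open>V \<subseteq> U\<close> by (simp add: W_def)
  ultimately show ?thesis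
    unfolding gaussian_curvature_rationally_bounded_def O'_def by blast
qed

lemma Gauss_map_singular_if_rationally_bounded:
  assumes p: "p \<in> V" and nd: "frechet_derivative \<Lambda> (at p) \<noteq> (\<lambda>_. 0)" and \<Lambda>p: "\<Lambda> p = 0"
    and rb: "gaussian_curvature_rationally_bounded U f p"
  shows "\<mu> p = 0"
proof -
  let ?\<Phi> = "blowup_map_at p" and ?K = "gaussian_curvature g"
  obtain W \<rho> \<psi> where W: "open W" "p \<in> W"
    and sm: "blowup_smooth_on \<rho> (?\<Phi> -` W)" "blowup_smooth_on \<psi> (?\<Phi> -` W)"
    and fin: "finite (\<rho> -` {0} \<inter> ?\<Phi> -` {p})"
    and K: "\<forall>x \<in> ?\<Phi> -` {q \<in> W. immersion_at f q}. \<psi> x = \<rho> x * ?K (?\<Phi> x)"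
    using rb unfolding gaussian_curvature_rationally_bounded_def rationally_bounded_at_def Let_def
    by (elim exE conjE) (rule that)
  obtain e where e: "e > 0" "ball p e \<subseteq> V \<inter> W"
    using open_Int[OF open_V W(1)] p W(2) by (metis IntI openE)
  have eV: "ball p e \<subseteq> V" and eW: "ball p e \<subseteq> W" using e(2) by auto
  let ?A = "{a :: real \<times> real. \<bar>fst a\<bar> < e}"
  obtain l where l: "smooth_on l ?A" "\<And>a. \<bar>fst a\<bar> < e \<Longrightarrow> \<Lambda> (p + polar a) = fst a * l a"
    "\<And>t. l (0, t) = cos t * pderiv_at 1 \<Lambda> p + sin t * pderiv_at 2 \<Lambda> p"
    "\<And>a (k::int). l (if even k then fst a else - fst a, snd a + of_int k * pi) = (if even k then l a else - l a)"
    by (rule polar_quotient[OF smooth_on_subset[OF smooth_\<Lambda> eV] e(1) \<Lambda>p]) (rule that)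
  let ?Z = "{blowup_proj (0, t) | t. cos t * pderiv_at 1 \<Lambda> p + sin t * pderiv_at 2 \<Lambda> p = 0}"
  have "pderiv_at 1 \<Lambda> p \<noteq> 0 \<or> pderiv_at 2 \<Lambda> p \<noteq> 0"
    by (rule pderiv_signed_area_density_nonzero[OF p nd])
  then have "finite (?Z \<union> (\<rho> -` {0} \<inter> ?\<Phi> -` {p}))"
    using finite_directions fin by blast
  \<comment> \<open>In this direction neither d lambda(p) nor \<open>\<rho>\<close> vanishes on the
    exceptional circle.\<close>
  then obtain t where t: "blowup_proj (0, t) \<notin> ?Z \<union> (\<rho> -` {0} \<inter> ?\<Phi> -` {p})"
    by (rule direction_avoiding_finite)
  have polar0: "polar (0, t) = 0" using norm_polar[of "(0, t)"] by simp
  have \<rho>0: "\<rho> (blowup_proj (0, t)) \<noteq> 0"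
    using t polar0 by (simp add: blowup_map_at_proj)
  have l0: "l (0, t) \<noteq> 0" using t l(3)[of t] by auto
  have sub: "?A \<subseteq> blowup_proj -` (?\<Phi> -` W)"
  proof
    fix a assume "a \<in> ?A"
    then have "p + polar a \<in> ball p e" by (simp add: dist_norm norm_polar)
    then show "a \<in> blowup_proj -` (?\<Phi> -` W)" using eW by (simp add: blowup_map_at_proj subset_iff)
  qed
  have iso: "isCont (\<lambda>r. h (r, t)) 0" if "smooth_on h ?A" for h :: "real \<times> real \<Rightarrow> real"
  proof (rule isCont_o2[where g = h])
    show "isCont (\<lambda>r. (r, t)) 0" by (intro continuous_intros)
    show "isCont h (0, t)"
      using smooth_on_continuous[OF that] open_strip e(1) by (intro continuous_on_interior) (auto simp: interior_open)
  qed
  \<comment> \<open>The relation psi lambda = rho \<mu> along the ray of direction \<open>t\<close>,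
    with lambda written as r l. At r = 0 only the second term survives, and it contains
    \<mu>(p).\<close>
  define F where "F r = \<psi> (blowup_proj (r, t)) * (r * l (r, t)) - \<rho> (blowup_proj (r, t)) * \<mu> (p + polar (r, t))" for r
  have "isCont (\<lambda>r. \<psi> (blowup_proj (r, t))) 0" "isCont (\<lambda>r. \<rho> (blowup_proj (r, t))) 0"
    using iso[OF smooth_on_subset[OF sm(2)[unfolded blowup_smooth_on_def] sub]]
      iso[OF smooth_on_subset[OF sm(1)[unfolded blowup_smooth_on_def] sub]] by simp_all
  moreover have "smooth_on (\<lambda>a. \<mu> (p + polar a)) ?A"
  proof (rule smooth_on_compose[OF open_strip open_ball _ _ smooth_on_subset[OF smooth_\<mu> eV]])
    show "p + polar a \<in> ball p e" if "a \<in> ?A" for a using that by (simp add: dist_norm norm_polar)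
    show "smooth_on (\<lambda>a. p + polar a) ?A"
      by (intro smooth_on_add smooth_on_const smooth_on_polar open_strip)
  qed
  note iso[OF this]
  ultimately have "isCont F 0"
    unfolding F_def by (intro continuous_intros iso[OF l(1)])
  then have "(F \<longlongrightarrow> F 0) (at 0)" by (simp add: isCont_def)
  moreover have "\<forall>\<^sub>F r in at 0. F r = 0"
  proof -
    \<comment> \<open>By continuity the ray consists of regular points near \<open>p\<close>, apart
      from \<open>p\<close> itself, so the formula for K applies on it.\<close>
    have "\<forall>\<^sub>F r in at 0. l (r, t) \<noteq> 0"
      using iso[OF l(1)] l0 by (simp add: isCont_def tendsto_imp_eventually_ne)
    moreover have "\<forall>\<^sub>F r in at (0::real). \<bar>r\<bar> < e \<and> r \<noteq> 0"
      using e(1) by (auto simp: eventually_at)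
    ultimately show ?thesis
    proof eventually_elim
      case (elim r)
      let ?q = "p + polar (r, t)"
      have q: "?q \<in> ball p e" using elim by (simp add: dist_norm norm_polar)
      have \<Lambda>q: "\<Lambda> ?q = r * l (r, t)" "\<Lambda> ?q \<noteq> 0" using l(2)[of "(r, t)"] elim by simp_all
      have "?q \<in> V" "?q \<in> W" using q eV eW by blast+
      then have "immersion_at f ?q" using \<Lambda>q(2) immersion_f_iff by simp
      then have "\<psi> (blowup_proj (r, t)) = \<rho> (blowup_proj (r, t)) * ?K ?q"
        using bspec[OF K, of "blowup_proj (r, t)"] \<open>?q \<in> W\<close> by (simp add: blowup_map_at_proj)
      also have "?K ?q = \<mu> ?q / \<Lambda> ?q"
        using \<Lambda>q(2) \<open>?q \<in> V\<close> by (intro gaussian_curvature_eq) simp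
      finally have "\<psi> (blowup_proj (r, t)) * \<Lambda> ?q = \<rho> (blowup_proj (r, t)) * \<mu> ?q"
        using \<Lambda>q(2) by simp
      then show "F r = 0"
        unfolding F_def \<Lambda>q(1)[symmetric] by simp
    qed
  qed
  then have "(F \<longlongrightarrow> 0) (at 0)" by (rule tendsto_eventually)
  ultimately have "F 0 = 0" using tendsto_unique[of "at (0::real)" F] by auto
  then show ?thesis using \<rho>0 polar0 by (simp add: F_def)
qed

end

theorem corollary3:
  fixes U V :: "(real^2) set" and f \<nu> :: "real^2 \<Rightarrow> real^3" and p :: "real^2"
  assumes "open U" and "connected U" and "p \<in> U"
    and "front U f"
    and "open V" and "p \<in> V" and "V \<subseteq> U" and "unit_normal_field V f \<nu>"
    and "nondegenerate_singular_point f \<nu> p"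
  shows "(gaussian_curvature_rationally_bounded U f p \<longleftrightarrow> limiting_normal_curvature f \<nu> p = 0) \<and>
         (limiting_normal_curvature f \<nu> p = 0 \<longleftrightarrow> \<not> immersion_at \<nu> p)"
proof -
  have "smooth_on f U" using assms(4) by (simp add: front_def)
  then interpret surface_with_normal V f \<nu>
    using assms(5,7,8) by unfold_locales (auto intro: smooth_on_subset)
  have nd: "frechet_derivative \<Lambda> (at p) \<noteq> (\<lambda>_. 0)" and sing: "\<not> immersion_at f p"
    using assms(9) by (auto simp: nondegenerate_singular_point_def)
  have fd: "f differentiable at p" by (rule smooth_on_differentiable[OF smooth_f assms(6)])
  obtain w where w: "frechet_derivative f (at p) w = 0" "w \<noteq> 0"
    using sing unfolding immersion_at_def linear_injective_0[OF linear_frechet_derivative[OF fd]] by blast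
  obtain a where a: "frechet_derivative f (at p) a \<noteq> 0"
    using ex_nonzero_derivative[OF assms(6) nd] by blast
  have "\<Lambda> p = 0" using sing immersion_f_iff[OF assms(6)] by simp
  \<comment> \<open>The vanishing of \<mu>(p) is the link between the curvature condition and the
    Gauss map.\<close>
  then have "gaussian_curvature_rationally_bounded U f p \<longleftrightarrow> \<mu> p = 0"
    using rationally_bounded_if_Gauss_map_singular[OF assms(6) nd assms(7)]
      Gauss_map_singular_if_rationally_bounded[OF assms(6) nd] by blast
  also have "\<dots> \<longleftrightarrow> \<not> immersion_at \<nu> p"
    using immersion_\<nu>_iff[OF assms(6)] by simp
  finally show ?thesis
    using limiting_normal_curvature_zero_iff[OF assms(6) w(1) front_kernel[OF assms(4,3,6) nd w] a] by blast
qed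

end
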